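(* Let $m$ be odd and let $n \in \mathbf{N}$. Let $\mathcal{P}$ be a closed set family of shape $(m^n)$ and type $\lambda$ (so $\lambda$ is a partition of $mn$), and let $u$ be the indexed set partition associated to $\mathcal{P}$. Then there is a well-defined homomorphism of $\mathbf{Z}S_{mn}$-modules $f_\mathcal{P} : S^\lambda \rightarrow H^{(m^n)}$ with $e_{t_\lambda} f_\mathcal{P} = u\, b_{t_\lambda}$, and $f_\mathcal{P}$ is injective.
   Context: Majorization: for $m$-subsets $X=\{x_1<\dots<x_m\}$, $Y=\{y_1<\dots<y_m\}$ of $\mathbf{N}=\{1,2,\dots\}$, write $X \preceq Y$ if $x_i \le y_i$ for all $i$. A set family of shape $(m^n)$ is a collection of $n$ distinct $m$-subsets of $\mathbf{N}$; it is closed if whenever $Y$ is in it and $X \preceq Y$ ($X$ an $m$-subset), $X$ is in it. If $\lambda$ is a partition with largest part $a$ and conjugate $\lambda'$, a set family has type $\lambda$ if for each $i\in\{1,\dots,a\}$ exactly $\lambda'_i$ of its sets contain $i$. Let $A(\lambda)=\{i_j : 1\le i\le a,\ 1\le j\le \lambda'_i\}$ (symbols with number $i$ and index $j$); $|A(\lambda)|=mn$ and $S_{mn}$ is identified with the symmetric group on $A(\lambda)$, acting on the right. The Foulkes module $H^{(m^n)}$ is the permutation $\mathbf{Z}S_{mn}$-module with $\mathbf{Z}$-basis the set partitions of $A(\lambda)$ into $n$ sets each of size $m$ (indexed set partitions). $M^\lambda$ is the Young permutation module on $\lambda$-tabloids (tableaux with entries $A(\lambda)$, rows unordered); for a $\lambda$-tableau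 $t$, $C(t)$ is its column stabilizer, $b_t=\sum_{\tau\in C(t)}\mathrm{sgn}(\tau)\tau$, $e_t=\{t\}b_t$ is the polytabloid, and the Specht module $S^\lambda\subseteq M^\lambda$ is the $\mathbf{Z}$-span of the polytabloids. $t_\lambda$ is the $\lambda$-tableau whose $i$-th column is $i_1,\dots,i_{\lambda'_i}$ from top to bottom. The indexed set partition associated to a set family $\mathcal{P}$ of shape $(m^n)$ and type $\lambda$: write $\mathcal{P}=\{X_1,\dots,X_n\}$ with $X_1<\dots<X_n$ in lexicographic order; give every element of $X_1$ index $1$, and give an element $i\in X_r$ the smallest index not already appended to an $i$ occurring in $X_1,\dots,X_{r-1}$. *)

theory Defs
  imports "HOL-Combinatorics.Permutations"
begin

type_synonym sym = "nat \<times> nat"  (* (number i, index j) *)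

definition is_partition :: "nat list \<Rightarrow> bool" where
  "is_partition lam \<longleftrightarrow> sorted_wrt (\<ge>) lam \<and> (\<forall>x\<in>set lam. 0 < x)"

definition largest_part :: "nat list \<Rightarrow> nat" where
  "largest_part lam = (if lam = [] then 0 else hd lam)"

definition conj :: "nat list \<Rightarrow> nat \<Rightarrow> nat" where
  "conj lam i = card {r. r < length lam \<and> i \<le> lam ! r}"

definition symbols :: "nat list \<Rightarrow> sym set" where
  "symbols lam = {(i,j). 1 \<le> i \<and> i \<le> largest_part lam \<and> 1 \<le> j \<and> j \<le> conj lam i}"

definition boxes :: "nat list \<Rightarrow> (nat \<times> nat) set" where
  "boxes lam = {(r,c). 1 \<le> r \<and> r \<le> length lam \<and> 1 \<le> c \<and> c \<le> lam ! (r - 1)}"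

definition tableau :: "nat list \<Rightarrow> (nat \<times> nat \<Rightarrow> sym) \<Rightarrow> bool" where
  "tableau lam t \<longleftrightarrow> bij_betw t (boxes lam) (symbols lam)"

definition t_lam :: "nat \<times> nat \<Rightarrow> sym" where
  "t_lam = (\<lambda>(r,c). (c,r))"

(* tabloid {t}: represented by the map sending each symbol to its row *)
type_synonym tabloid = "sym \<Rightarrow> nat"

definition tabloid_of :: "nat list \<Rightarrow> (nat \<times> nat \<Rightarrow> sym) \<Rightarrow> tabloid" where
  "tabloid_of lam t = (\<lambda>x. if x \<in> symbols lam then fst (inv_into (boxes lam) t x) else 0)"

(* right action of a permutation sigma of the symbols on tabloids: {t} sigma = {t sigma} *)
definition tab_act :: "tabloid \<Rightarrow> (sym \<Rightarrow> sym) \<Rightarrow> tabloid" where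
  "tab_act T \<sigma> = T \<circ> inv \<sigma>"

definition col_stab :: "nat list \<Rightarrow> (nat \<times> nat \<Rightarrow> sym) \<Rightarrow> (sym \<Rightarrow> sym) set" where
  "col_stab lam t = {\<tau>. \<tau> permutes symbols lam \<and>
     (\<forall>x\<in>symbols lam. snd (inv_into (boxes lam) t (\<tau> x)) = snd (inv_into (boxes lam) t x))}"

(* Z-linear combinations of basis elements are finitely supported functions basis => int;
   right action of a permutation extended linearly *)
definition vec_act :: "('b \<Rightarrow> (sym \<Rightarrow> sym) \<Rightarrow> 'b) \<Rightarrow> ('b \<Rightarrow> int) \<Rightarrow> (sym \<Rightarrow> sym) \<Rightarrow> ('b \<Rightarrow> int)" where
  "vec_act act v \<sigma> = (\<lambda>b. v (act b (inv \<sigma>)))"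

definition polytabloid :: "nat list \<Rightarrow> (nat \<times> nat \<Rightarrow> sym) \<Rightarrow> (tabloid \<Rightarrow> int)" where
  "polytabloid lam t = (\<lambda>T. \<Sum>\<tau>\<in>col_stab lam t. if tab_act (tabloid_of lam t) \<tau> = T then sign \<tau> else 0)"

definition span_Z :: "('b \<Rightarrow> int) set \<Rightarrow> ('b \<Rightarrow> int) set" where
  "span_Z G = {v. \<exists>F c. finite F \<and> F \<subseteq> G \<and> v = (\<lambda>x. \<Sum>g\<in>F. c g * g x)}"

definition specht :: "nat list \<Rightarrow> (tabloid \<Rightarrow> int) set" where
  "specht lam = span_Z {polytabloid lam t | t. tableau lam t}"

definition isp :: "nat \<Rightarrow> nat \<Rightarrow> nat list \<Rightarrow> sym set set set" where
  "isp m n lam = {U. card U = n \<and> (\<forall>B\<in>U. B \<subseteq> symbols lam \<and> card B = m) \<and>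
                      \<Union>U = symbols lam \<and> pairwise disjnt U}"

definition isp_act :: "sym set set \<Rightarrow> (sym \<Rightarrow> sym) \<Rightarrow> sym set set" where
  "isp_act U \<sigma> = (\<lambda>B. \<sigma> ` B) ` U"

definition foulkes :: "nat \<Rightarrow> nat \<Rightarrow> nat list \<Rightarrow> (sym set set \<Rightarrow> int) set" where
  "foulkes m n lam = {h. finite {U. h U \<noteq> 0} \<and> (\<forall>U. h U \<noteq> 0 \<longrightarrow> U \<in> isp m n lam)}"

definition m_subset :: "nat \<Rightarrow> nat set \<Rightarrow> bool" where
  "m_subset m X \<longleftrightarrow> finite X \<and> card X = m \<and> X \<subseteq> {1..}"

definition majorized :: "nat set \<Rightarrow> nat set \<Rightarrow> bool" where
  "majorized X Y \<longleftrightarrow> list_all2 (\<le>) (sorted_list_of_set X) (sorted_list_of_set Y)"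

definition set_family :: "nat \<Rightarrow> nat \<Rightarrow> nat set set \<Rightarrow> bool" where
  "set_family m n P \<longleftrightarrow> finite P \<and> card P = n \<and> (\<forall>X\<in>P. m_subset m X)"

definition closed_family :: "nat \<Rightarrow> nat set set \<Rightarrow> bool" where
  "closed_family m P \<longleftrightarrow> (\<forall>Y\<in>P. \<forall>X. m_subset m X \<and> majorized X Y \<longrightarrow> X \<in> P)"

definition has_type :: "nat set set \<Rightarrow> nat list \<Rightarrow> bool" where
  "has_type P lam \<longleftrightarrow> (\<forall>i\<in>{1..largest_part lam}. card {X\<in>P. i \<in> X} = conj lam i)"

definition lex_less :: "nat set \<Rightarrow> nat set \<Rightarrow> bool" where
  "lex_less X Y \<longleftrightarrow> (sorted_list_of_set X, sorted_list_of_set Y) \<in> lexord {(a,b). a < b}"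

definition lex_list :: "nat set set \<Rightarrow> nat set list" where
  "lex_list P = (THE Xs. distinct Xs \<and> set Xs = P \<and> sorted_wrt lex_less Xs)"

(* index assignment: used i = indices already appended to i *)
fun assign_idx :: "nat set list \<Rightarrow> (nat \<Rightarrow> nat set) \<Rightarrow> sym set list" where
  "assign_idx [] used = []"
| "assign_idx (X # Xs) used =
     (let ix = (\<lambda>i. LEAST j. 1 \<le> j \<and> j \<notin> used i) in
       ((\<lambda>i. (i, ix i)) ` X) #
       assign_idx Xs (\<lambda>i. if i \<in> X then insert (ix i) (used i) else used i))"

definition assoc_isp :: "nat set set \<Rightarrow> sym set set" where
  "assoc_isp P = set (assign_idx (lex_list P) (\<lambda>_. {}))"

end

theory Submission
  imports Defs "HOL-Library.List_Lexorder" "HOL-Library.Nat_Bijection"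
begin

text \<open>Write \<open>b\<close> for the signed column sum and \<open>r\<close> for the row sum of \<open>t_lam\<close>, and \<open>v = u b\<close>. Since \<open>m\<close> is odd and
  the family is closed, exchanging a symbol of column \<open>j\<close> with all symbols of an earlier column \<open>i\<close> and
  summing fixes \<open>v\<close>: each exchange gives a repeated number or two equal sets (hence \<open>0\<close>), except one, which
  returns \<open>v\<close>. So the sum \<open>T\<close> of all transpositions acts on \<open>v\<close> by the sum of the contents of the diagram.

  A nonzero vector \<open>x\<close> alternating under the column group on which \<open>T\<close> acts by this scalar satisfies
  \<open>x r \<noteq> 0\<close>: choose a partition of the symbols into rows, with row sum \<open>r'\<close> and \<open>x r' \<noteq> 0\<close>, maximising the sum
  of the squares of the row lengths. Moving a symbol into a row at least as long as its own then annihilates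
  \<open>x\<close>, which computes \<open>T\<close> on \<open>x r'\<close>. Comparing the two scalars by double counting forces the rows to be
  those of the diagram, up to a column permutation.

  Applied to \<open>v r b - \<kappa> v\<close>, where \<open>\<kappa>\<close> is the integer with \<open>v r b r = \<kappa> v r\<close>, this gives \<open>v r b = \<kappa> v\<close>, and
  \<open>\<kappa> \<noteq> 0\<close>. Hence the map of permutation modules sending \<open>{t_lam}\<close> to \<open>v r\<close> takes values divisible by \<open>\<kappa>\<close> on the
  Specht module, and its quotient by \<open>\<kappa>\<close> is the required map. It is injective because pairing with the
  translates of \<open>v r\<close> recovers the coefficients of an element of the Specht module.\<close>

section \<open>Sums over stabilisers\<close>

text \<open>One notion serves for the column group (\<open>\<mu> = fst\<close>), the row group
  (\<open>\<mu> = snd\<close>) and the row group of any other division of the symbols into labelled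
  rows; the extremal argument varies the rows.\<close>

definition stab :: "'a set \<Rightarrow> ('a \<Rightarrow> 'b) \<Rightarrow> ('a \<Rightarrow> 'a) set" where
  "stab A \<mu> = {\<rho>. \<rho> permutes A \<and> (\<forall>x\<in>A. \<mu> (\<rho> x) = \<mu> x)}"

lemma stabD: "\<rho> \<in> stab A \<mu> \<Longrightarrow> \<rho> permutes A" "\<rho> \<in> stab A \<mu> \<Longrightarrow> x \<in> A \<Longrightarrow> \<mu> (\<rho> x) = \<mu> x"
  by (auto simp: stab_def)

lemma id_stab: "id \<in> stab A \<mu>"
  by (auto simp: stab_def permutes_id)

lemma stab_comp: "\<rho> \<in> stab A \<mu> \<Longrightarrow> \<sigma> \<in> stab A \<mu> \<Longrightarrow> \<rho> \<circ> \<sigma> \<in> stab A \<mu>"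
  by (auto simp: stab_def permutes_compose permutes_in_image)

lemma stab_inv: "\<rho> \<in> stab A \<mu> \<Longrightarrow> inv \<rho> \<in> stab A \<mu>"
proof -
  assume \<rho>: "\<rho> \<in> stab A \<mu>"
  have "\<mu> (inv \<rho> x) = \<mu> x" if "x \<in> A" for x
    using stabD(2)[OF \<rho>, of "inv \<rho> x"] that permutes_in_image[OF permutes_inv[OF stabD(1)[OF \<rho>]], of x]
      permutes_inverses[OF stabD(1)[OF \<rho>]] by auto
  then show ?thesis using permutes_inv[OF stabD(1)[OF \<rho>]] by (simp add: stab_def)
qed

lemma finite_stab: "finite A \<Longrightarrow> finite (stab A \<mu>)"
  by (rule finite_subset[OF _ finite_permutations[of A]]) (auto simp: stab_def)

lemma card_stab_pos: "finite A \<Longrightarrow> card (stab A \<mu>) > 0"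
  using finite_stab[of A \<mu>] id_stab[of A \<mu>] by (auto simp: card_gt_0_iff)

lemma transpose_stab: "p \<in> A \<Longrightarrow> q \<in> A \<Longrightarrow> \<mu> p = \<mu> q \<Longrightarrow> transpose p q \<in> stab A \<mu>"
  by (auto simp: stab_def permutes_swap_id transpose_def)

lemma comp_inv_cancel:
  assumes "k permutes A"
  shows "k \<circ> inv k = id" "inv k \<circ> k = id" "g \<circ> k \<circ> inv k = g" "g \<circ> inv k \<circ> k = g"
    "k \<circ> (inv k \<circ> h) = h" "inv k \<circ> (k \<circ> h) = h"
  using permutes_inv_o[OF assms] by (auto simp: comp_assoc) (simp_all flip: comp_assoc)

lemma sum_stab_right:
  assumes "\<sigma> \<in> stab A \<mu>"
  shows "(\<Sum>\<rho>\<in>stab A \<mu>. H (\<rho> \<circ> \<sigma>)) = (\<Sum>\<rho>\<in>stab A \<mu>. H \<rho>)"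
  by (rule sum.reindex_bij_witness[of _ "\<lambda>\<rho>. \<rho> \<circ> inv \<sigma>" "\<lambda>\<rho>. \<rho> \<circ> \<sigma>"])
     (use assms in \<open>auto simp: comp_inv_cancel[OF stabD(1)[OF assms]] intro!: stab_comp stab_inv\<close>)

lemma sum_stab_left:
  assumes "\<sigma> \<in> stab A \<mu>"
  shows "(\<Sum>\<rho>\<in>stab A \<mu>. H (\<sigma> \<circ> \<rho>)) = (\<Sum>\<rho>\<in>stab A \<mu>. H \<rho>)"
  by (rule sum.reindex_bij_witness[of _ "\<lambda>\<rho>. inv \<sigma> \<circ> \<rho>" "\<lambda>\<rho>. \<sigma> \<circ> \<rho>"])
     (use assms in \<open>auto simp: comp_inv_cancel[OF stabD(1)[OF assms]] intro!: stab_comp stab_inv\<close>)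

lemma stab_conj:
  assumes k: "k permutes A" and \<rho>: "\<rho> \<in> stab A (\<mu> \<circ> k)"
  shows "k \<circ> \<rho> \<circ> inv k \<in> stab A \<mu>"
proof -
  have "\<mu> (k (\<rho> (inv k x))) = \<mu> x" if "x \<in> A" for x
    using stabD(2)[OF \<rho>, of "inv k x"] that permutes_in_image[OF permutes_inv[OF k], of x]
      permutes_inverses[OF k] by auto
  then show ?thesis
    using k \<rho> by (auto simp: stab_def intro!: permutes_compose permutes_inv)
qed

lemma sum_stab_conj:
  assumes k: "k permutes A"
  shows "(\<Sum>\<rho>\<in>stab A \<mu>. H \<rho>) = (\<Sum>\<rho>\<in>stab A (\<mu> \<circ> k). H (k \<circ> \<rho> \<circ> inv k))"
proof (rule sum.reindex_bij_witness[of _ "\<lambda>\<rho>. k \<circ> \<rho> \<circ> inv k" "\<lambda>\<rho>. inv k \<circ> \<rho> \<circ> k"])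
  fix \<rho> assume "\<rho> \<in> stab A \<mu>"
  moreover have "\<mu> = \<mu> \<circ> k \<circ> inv k" by (simp add: comp_inv_cancel[OF k])
  ultimately have "\<rho> \<in> stab A (\<mu> \<circ> k \<circ> inv k)" by simp
  from stab_conj[OF permutes_inv[OF k] this]
  show "inv k \<circ> \<rho> \<circ> k \<in> stab A (\<mu> \<circ> k)"
    using k by (simp add: permutes_inv_inv)
  show "k \<circ> (inv k \<circ> \<rho> \<circ> k) \<circ> inv k = \<rho>"
    by (simp add: comp_inv_cancel[OF k] comp_assoc)
next
  fix \<rho> assume "\<rho> \<in> stab A (\<mu> \<circ> k)"
  then show "k \<circ> \<rho> \<circ> inv k \<in> stab A \<mu>" by (rule stab_conj[OF k])
  show "inv k \<circ> (k \<circ> \<rho> \<circ> inv k) \<circ> k = \<rho>"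
    by (simp add: comp_inv_cancel[OF k] comp_assoc)
qed (auto simp: comp_inv_cancel[OF k] comp_assoc)

lemma sum_permutes_right:
  assumes "\<sigma> permutes A"
  shows "(\<Sum>g | g permutes A. H (g \<circ> \<sigma>)) = (\<Sum>g | g permutes A. H g)"
  \<comment> \<open>A constant labelling is stabilised by the whole symmetric group.\<close>
  using sum_stab_right[of \<sigma> A "\<lambda>_. ()" H] assms by (simp add: stab_def)

lemma sum_permutes_left:
  assumes "\<sigma> permutes A"
  shows "(\<Sum>g | g permutes A. H (\<sigma> \<circ> g)) = (\<Sum>g | g permutes A. H g)"
  using sum_stab_left[of \<sigma> A "\<lambda>_. ()" H] assms by (simp add: stab_def)

text \<open>A vector \<open>x\<close> is studied through the functions \<open>F\<close> with \<open>F g\<close> the coefficient of \<open>x g\<close> at a fixed basis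
  element. Permutations act on the right, so \<open>F (g \<circ> \<rho>)\<close> belongs to \<open>x \<rho> g\<close>.\<close>

definition stab_sum :: "'a set \<Rightarrow> ('a \<Rightarrow> 'b) \<Rightarrow> (('a \<Rightarrow> 'a) \<Rightarrow> int) \<Rightarrow> ('a \<Rightarrow> 'a) \<Rightarrow> int" where
  "stab_sum A \<mu> F g = (\<Sum>\<rho>\<in>stab A \<mu>. F (g \<circ> \<rho>))"

lemma stab_sum_invariant: "\<sigma> \<in> stab A \<mu> \<Longrightarrow> stab_sum A \<mu> F (g \<circ> \<sigma>) = stab_sum A \<mu> F g"
  unfolding stab_sum_def using sum_stab_left[of \<sigma> A \<mu> "\<lambda>\<rho>. F (g \<circ> \<rho>)"] by (simp add: comp_assoc)

text \<open>Since \<open>\<rho> \<circ> k = k \<circ> (inv k \<circ> \<rho> \<circ> k)\<close>, and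
  conjugation by \<open>k\<close> amounts to relabelling, a permutation can be moved past a row
  sum.\<close>

lemma stab_sum_translate:
  assumes k: "k permutes A"
  shows "(\<Sum>\<rho>\<in>stab A \<mu>. F (g \<circ> \<rho> \<circ> k)) = stab_sum A (\<mu> \<circ> k) F (g \<circ> k)"
  unfolding stab_sum_def
  using sum_stab_conj[OF k, where \<mu> = \<mu> and H = "\<lambda>\<rho>. F (g \<circ> \<rho> \<circ> k)"]
  by (simp add: comp_inv_cancel[OF k] comp_assoc)

text \<open>For the vector \<open>x\<close> behind \<open>F\<close> this is
  \<open>x \<tau> = sgn(\<tau>) x\<close>, for all \<open>\<tau>\<close> in the group of
  \<open>f\<close>.\<close>

definition alternating :: "'a set \<Rightarrow> ('a \<Rightarrow> 'b) \<Rightarrow> (('a \<Rightarrow> 'a) \<Rightarrow> int) \<Rightarrow> bool" where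
  "alternating A f F \<longleftrightarrow> (\<forall>g \<tau>. g permutes A \<longrightarrow> \<tau> \<in> stab A f \<longrightarrow> F (g \<circ> \<tau>) = sign \<tau> * F g)"

lemma alternatingD:
  "alternating A f F \<Longrightarrow> g permutes A \<Longrightarrow> \<tau> \<in> stab A f \<Longrightarrow> F (g \<circ> \<tau>) = sign \<tau> * F g"
  by (auto simp: alternating_def)

text \<open>The transposition of \<open>p\<close> and \<open>q\<close> lies in both groups: it
  permutes the summands and changes the sign of each, so the sum equals its negative.\<close>

lemma stab_sum_eq_0:
  assumes F: "alternating A f F" and g: "g permutes A"
    and pq: "p \<in> A" "q \<in> A" "p \<noteq> q" "f p = f q" "\<mu> p = \<mu> q"
  shows "stab_sum A \<mu> F g = 0"
proof -
  have "stab_sum A \<mu> F g = (\<Sum>\<rho>\<in>stab A \<mu>. F (g \<circ> (\<rho> \<circ> transpose p q)))"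
    unfolding stab_sum_def using sum_stab_right[OF transpose_stab[OF pq(1,2,5)], of "\<lambda>\<rho>. F (g \<circ> \<rho>)"] by simp
  also have "\<dots> = (\<Sum>\<rho>\<in>stab A \<mu>. - F (g \<circ> \<rho>))"
  proof (rule sum.cong)
    fix \<rho> assume "\<rho> \<in> stab A \<mu>"
    then have "g \<circ> \<rho> permutes A" using g by (auto dest: stabD(1) intro: permutes_compose)
    from alternatingD[OF F this transpose_stab[OF pq(1,2,4)]]
    show "F (g \<circ> (\<rho> \<circ> transpose p q)) = - F (g \<circ> \<rho>)"
      using pq(3) by (simp add: comp_assoc sign_swap_id)
  qed simp
  finally show ?thesis unfolding stab_sum_def by (simp add: sum_negf)
qed

text \<open>Ordered pairs, with \<open>x = y\<close> included, split neatly along the fibres of a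
  labelling. For finite \<open>A\<close>, every transposition counts twice and the identity
  \<open>card A\<close> times.\<close>

definition all_transpositions :: "'a set \<Rightarrow> (('a \<Rightarrow> 'a) \<Rightarrow> int) \<Rightarrow> ('a \<Rightarrow> 'a) \<Rightarrow> int" where
  "all_transpositions A F g = (\<Sum>x\<in>A. \<Sum>y\<in>A. F (g \<circ> transpose x y))"

lemma transpose_conj:
  assumes "k permutes A"
  shows "k \<circ> transpose x y = transpose (k x) (k y) \<circ> k"
  using permutes_inj[OF assms] by (auto simp: fun_eq_iff transpose_def inj_eq)

text \<open>Conjugation by \<open>k\<close> only permutes the pairs \<open>(x, y)\<close>, so the
  sum of all transpositions is central.\<close>

lemma all_transpositions_conj:
  assumes k: "k permutes A"
  shows "(\<Sum>x\<in>A. \<Sum>y\<in>A. F (g \<circ> transpose x y \<circ> k)) = all_transpositions A F (g \<circ> k)"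
proof -
  have "all_transpositions A F (g \<circ> k) = (\<Sum>x\<in>A. \<Sum>y\<in>A. F (g \<circ> (transpose (k x) (k y) \<circ> k)))"
    unfolding all_transpositions_def by (simp add: comp_assoc flip: transpose_conj[OF k])
  also have "\<dots> = (\<Sum>x\<in>A. \<Sum>y\<in>A. F (g \<circ> (transpose (k x) y \<circ> k)))"
  proof (rule sum.cong)
    fix x
    show "(\<Sum>y\<in>A. F (g \<circ> (transpose (k x) (k y) \<circ> k))) = (\<Sum>y\<in>A. F (g \<circ> (transpose (k x) y \<circ> k)))"
      using sum.permute[OF k, of "\<lambda>y. F (g \<circ> (transpose (k x) y \<circ> k))"] by (simp add: o_def)
  qed simp
  also have "\<dots> = (\<Sum>x\<in>A. \<Sum>y\<in>A. F (g \<circ> (transpose x y \<circ> k)))"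
    using sum.permute[OF k, of "\<lambda>x. \<Sum>y\<in>A. F (g \<circ> (transpose x y \<circ> k))"] by (simp add: o_def)
  finally show ?thesis by (simp add: comp_assoc)
qed

section \<open>The sum of the squares of the row lengths\<close>

definition potential :: "'a set \<Rightarrow> ('a \<Rightarrow> 'b) \<Rightarrow> nat" where
  "potential A \<mu> = (\<Sum>x\<in>A. card {y \<in> A. \<mu> y = \<mu> x})"

lemma potential_permute:
  assumes k: "k permutes A"
  shows "potential A (\<mu> \<circ> k) = potential A \<mu>"
proof -
  have "card {y \<in> A. \<mu> (k y) = l} = card {y \<in> A. \<mu> y = l}" for l
  proof (rule bij_betw_same_card[of k])
    show "bij_betw k {y \<in> A. \<mu> (k y) = l} {y \<in> A. \<mu> y = l}"
      by (rule bij_betw_byWitness[of _ "inv k"])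
         (auto simp: permutes_inverses[OF k] permutes_in_image[OF k] permutes_in_image[OF permutes_inv[OF k]])
  qed
  then have "potential A (\<mu> \<circ> k) = (\<Sum>x\<in>A. card {y \<in> A. \<mu> y = \<mu> (k x)})"
    by (simp add: potential_def)
  also have "\<dots> = potential A \<mu>"
    unfolding potential_def by (rule sum.permute[OF k, symmetric, unfolded o_def])
  finally show ?thesis .
qed

lemma potential_le: "finite A \<Longrightarrow> potential A \<mu> \<le> card A * card A"
  unfolding potential_def by (rule sum_bounded_above[of A _ "card A", simplified]) (auto intro: card_mono)

text \<open>Rows of lengths \<open>p \<le> q\<close> become rows of lengths \<open>p - 1\<close> and
  \<open>q + 1\<close>, so the sum of the squares grows by \<open>2 (q - p) + 2\<close>.\<close>

lemma potential_move:
  assumes A: "finite A" and y: "y \<in> A" and l: "l \<noteq> \<mu> y"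
    and le: "card {x \<in> A. \<mu> x = \<mu> y} \<le> card {x \<in> A. \<mu> x = l}"
  shows "potential A \<mu> < potential A (\<mu>(y := l))"
proof -
  let ?\<nu> = "\<mu>(y := l)"
  define K' where "K' \<kappa> = {z \<in> A \<times> A. \<kappa> (fst z) = \<kappa> (snd z)}" for \<kappa> :: "'a \<Rightarrow> 'b"
  have pot: "potential A \<kappa> = card (K' \<kappa>)" for \<kappa>
  proof -
    have "potential A \<kappa> = card (SIGMA x:A. {y \<in> A. \<kappa> y = \<kappa> x})"
      using A by (simp add: potential_def)
    also have "(SIGMA x:A. {y \<in> A. \<kappa> y = \<kappa> x}) = K' \<kappa>" by (auto simp: K'_def)
    finally show ?thesis .
  qed
  define A' where "A' = A - {y}"
  define K where "K \<kappa> = {z \<in> A' \<times> A'. \<kappa> (fst z) = \<kappa> (snd z)}" for \<kappa> :: "'a \<Rightarrow> 'b"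
  define r where "r \<kappa> = {x \<in> A'. \<kappa> x = \<kappa> y}" for \<kappa> :: "'a \<Rightarrow> 'b"
  have fin: "finite A'" "\<And>\<kappa>. finite (K \<kappa>)" "\<And>\<kappa>. finite (r \<kappa>)"
    using A by (auto simp: A'_def K_def r_def)
  \<comment> \<open>A pair with equal labels avoids \<open>y\<close>, contains it exactly once (in
    either order), or is \<open>(y, y)\<close>. Moving \<open>y\<close> changes only the number of
    pairs of the second kind.\<close>
  have dec: "card (K' \<kappa>) = card (K \<kappa>) + 2 * card (r \<kappa>) + 1" for \<kappa>
  proof -
    have "K' \<kappa> = insert (y,y) (K \<kappa> \<union> ((\<lambda>x. (x,y)) ` r \<kappa> \<union> (\<lambda>x. (y,x)) ` r \<kappa>))"
      using y by (auto simp: K_def K'_def r_def A'_def)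
    moreover have "card ((\<lambda>x. (x,y)) ` r \<kappa>) = card (r \<kappa>)" "card ((\<lambda>x. (y,x)) ` r \<kappa>) = card (r \<kappa>)"
      by (auto intro!: card_image inj_onI)
    moreover have "(\<lambda>x. (x,y)) ` r \<kappa> \<inter> (\<lambda>x. (y,x)) ` r \<kappa> = {}"
      "K \<kappa> \<inter> ((\<lambda>x. (x,y)) ` r \<kappa> \<union> (\<lambda>x. (y,x)) ` r \<kappa>) = {}"
      "(y,y) \<notin> K \<kappa> \<union> ((\<lambda>x. (x,y)) ` r \<kappa> \<union> (\<lambda>x. (y,x)) ` r \<kappa>)"
      by (auto simp: K_def r_def A'_def)
    ultimately show ?thesis using fin by (simp add: card_Un_disjoint)
  qed
  have "K ?\<nu> = K \<mu>" by (auto simp: K_def A'_def)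
  moreover have "r ?\<nu> = {x \<in> A. \<mu> x = l}" using l by (auto simp: r_def A'_def)
  moreover have "{x \<in> A. \<mu> x = \<mu> y} = insert y (r \<mu>)" using y by (auto simp: r_def A'_def)
  then have "card {x \<in> A. \<mu> x = \<mu> y} = Suc (card (r \<mu>))"
    using fin by (simp add: r_def A'_def)
  ultimately show ?thesis using le by (simp add: pot dec)
qed

section \<open>The sum of all transpositions\<close>

text \<open>An analogue of the Garnir relations. With the term \<open>x = y\<close> added, the sum
  is invariant under the group of the labelling in which \<open>y\<close> has moved to row
  \<open>l\<close>. Up to a positive factor it is therefore a sum of stabiliser sums for
  relabellings of that labelling, and these vanish because the potential has grown.\<close>

lemma stab_sum_transfer:
  fixes \<mu> :: "'a \<Rightarrow> 'b"
  assumes A: "finite A" and g: "g permutes A" and y: "y \<in> A" and l: "l \<noteq> \<mu> y"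
    and van: "\<And>(\<nu> :: 'a \<Rightarrow> 'b) g. potential A \<nu> > potential A \<mu> \<Longrightarrow> g permutes A \<Longrightarrow> stab_sum A \<nu> F g = 0"
    and le: "card {x \<in> A. \<mu> x = \<mu> y} \<le> card {x \<in> A. \<mu> x = l}"
  shows "(\<Sum>x\<in>{x\<in>A. \<mu> x = l}. stab_sum A \<mu> F (g \<circ> transpose x y)) = - stab_sum A \<mu> F g"
proof -
  define \<nu> where "\<nu> = \<mu>(y := l)"
  define X where "X = insert y {x\<in>A. \<mu> x = l}"
  have X: "X = {x \<in> A. \<nu> x = l}" using y by (auto simp: X_def \<nu>_def)
  have finX: "finite X" using A by (simp add: X)
  let ?w = "stab_sum A \<mu> F"
  define W where "W g = (\<Sum>x\<in>X. ?w (g \<circ> transpose x y))" for g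
  have W_inv: "W (g \<circ> \<rho>) = W g" if \<rho>: "\<rho> \<in> stab A \<nu>" for g \<rho>
  proof -
    note \<rho>p = stabD(1)[OF \<rho>]
    have bij: "bij_betw \<rho> X X"
      by (rule bij_betw_byWitness[of _ "inv \<rho>"])
         (use \<rho> stab_inv[OF \<rho>] in \<open>auto simp: X permutes_inverses[OF \<rho>p] permutes_in_image[OF \<rho>p]
            permutes_in_image[OF permutes_inv[OF \<rho>p]] dest: stabD(2)\<close>)
    have "?w (g \<circ> \<rho> \<circ> transpose x y) = ?w (g \<circ> transpose (\<rho> x) y)" if x: "x \<in> X" for x
    proof -
      \<comment> \<open>\<open>\<rho>'\<close> is what remains of \<open>\<rho>\<close> once the
        transposition has been moved to its other side. It fixes \<open>y\<close>; both
        transpositions exchange symbols of equal \<open>\<nu>\<close>-label, and away from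
        \<open>y\<close> the labellings \<open>\<mu>\<close> and \<open>\<nu>\<close> agree, so
        \<open>\<rho>'\<close> preserves \<open>\<mu>\<close>.\<close>
      define \<rho>' where "\<rho>' = transpose (\<rho> x) y \<circ> \<rho> \<circ> transpose x y"
      have xA: "x \<in> A" "\<rho> x \<in> X" "\<rho> x \<in> A" using x bij by (auto simp: X bij_betw_def)
      have "\<rho>' permutes A"
        unfolding \<rho>'_def using xA y \<rho>p by (intro permutes_compose permutes_swap_id) auto
      moreover have "\<mu> (\<rho>' z) = \<mu> z" if z: "z \<in> A" for z
      proof (cases "z = y")
        case True then show ?thesis by (simp add: \<rho>'_def)
      next
        case False
        define z' where "z' = transpose x y z"
        have z': "z' \<in> A" "z' \<noteq> x" "\<nu> z' = \<nu> z"
          using x xA y z False by (auto simp: z'_def transpose_def X \<nu>_def)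
        have "\<rho> z' \<noteq> \<rho> x" using z'(2) permutes_inj[OF \<rho>p] by (simp add: inj_eq)
        moreover have "\<nu> (\<rho> z') = \<nu> z" "\<rho> z' \<in> A"
          using stabD(2)[OF \<rho> z'(1)] z' permutes_in_image[OF \<rho>p] by auto
        moreover have "\<rho>' z = transpose (\<rho> x) y (\<rho> z')" by (simp add: \<rho>'_def z'_def)
        ultimately have "\<nu> (\<rho>' z) = \<nu> z" "\<rho>' z \<noteq> y"
          using xA y by (auto simp: transpose_def X \<nu>_def split: if_splits)
        then show ?thesis using False by (simp add: \<nu>_def)
      qed
      ultimately have "\<rho>' \<in> stab A \<mu>" by (simp add: stab_def)
      moreover have "\<rho> \<circ> transpose x y = transpose (\<rho> x) y \<circ> \<rho>'"
        by (simp add: \<rho>'_def fun_eq_iff)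
      then have "g \<circ> \<rho> \<circ> transpose x y = g \<circ> transpose (\<rho> x) y \<circ> \<rho>'" by (simp add: comp_assoc)
      ultimately show ?thesis by (simp add: stab_sum_invariant)
    qed
    then have "W (g \<circ> \<rho>) = (\<Sum>x\<in>X. ?w (g \<circ> transpose (\<rho> x) y))" by (simp add: W_def)
    also have "\<dots> = W g" unfolding W_def by (rule sum.reindex_bij_betw[OF bij])
    finally show ?thesis .
  qed
  have pot: "potential A \<nu> > potential A \<mu>"
    unfolding \<nu>_def by (rule potential_move[OF A y l le])
  \<comment> \<open>Averaging over the group of \<open>\<nu>\<close> puts its sum to the left of
    \<open>transpose x y \<circ> \<rho>'\<close>, which then merely relabels \<open>\<nu>\<close>
    and keeps its potential.\<close>
  have "int (card (stab A \<nu>)) * W g = (\<Sum>\<rho>\<in>stab A \<nu>. W (g \<circ> \<rho>))"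
    by (simp add: W_inv)
  also have "\<dots> = (\<Sum>x\<in>X. \<Sum>\<rho>'\<in>stab A \<mu>. \<Sum>\<rho>\<in>stab A \<nu>. F (g \<circ> \<rho> \<circ> (transpose x y \<circ> \<rho>')))"
    unfolding W_def stab_sum_def
    by (subst sum.swap, rule sum.cong[OF refl], subst sum.swap) (simp add: comp_assoc)
  also have "\<dots> = 0"
  proof (rule sum.neutral, intro ballI, rule sum.neutral, intro ballI)
    fix x \<rho>' assume "x \<in> X" "\<rho>' \<in> stab A \<mu>"
    then have k: "transpose x y \<circ> \<rho>' permutes A"
      using y by (auto simp: X dest: stabD(1) intro!: permutes_compose permutes_swap_id)
    show "(\<Sum>\<rho>\<in>stab A \<nu>. F (g \<circ> \<rho> \<circ> (transpose x y \<circ> \<rho>'))) = 0"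
      unfolding stab_sum_translate[OF k]
      by (rule van) (auto simp: potential_permute[OF k] pot intro: permutes_compose k g)
  qed
  finally have "W g = 0" using card_stab_pos[OF A, of \<nu>] by simp
  moreover have "W g = ?w g + (\<Sum>x\<in>{x\<in>A. \<mu> x = l}. ?w (g \<circ> transpose x y))"
    unfolding W_def X_def using A l by simp
  ultimately show ?thesis by simp
qed

lemma sum_swap3:
  "(\<Sum>x\<in>A. \<Sum>y\<in>B. \<Sum>z\<in>C. H x y z) = (\<Sum>z\<in>C. \<Sum>x\<in>A. \<Sum>y\<in>B. H x y z)"
  by (simp add: sum.swap[of _ C])

section \<open>Double counting of equal labels\<close>

definition same_label :: "'a set \<Rightarrow> ('a \<Rightarrow> 'b) \<Rightarrow> int" where
  "same_label A f = (\<Sum>x\<in>A. \<Sum>y\<in>A. of_bool (f x = f y))"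

definition min_overlap :: "'a set \<Rightarrow> ('a \<Rightarrow> 'b) \<Rightarrow> int" where
  "min_overlap A f = (\<Sum>i\<in>f ` A. \<Sum>j\<in>f ` A - {i}. int (min (card {x\<in>A. f x = i}) (card {x\<in>A. f x = j})))"

lemma sum_by_fibres:
  assumes A: "finite A"
  shows "(\<Sum>x\<in>A. \<Sum>y\<in>A. H x y :: int) =
    (\<Sum>i\<in>f ` A. \<Sum>x\<in>{x\<in>A. f x = i}. \<Sum>y\<in>{y\<in>A. f y = i}. H x y) +
    (\<Sum>i\<in>f ` A. \<Sum>j\<in>f ` A - {i}. \<Sum>x\<in>{x\<in>A. f x = i}. \<Sum>y\<in>{y\<in>A. f y = j}. H x y)"
proof -
  have "(\<Sum>x\<in>A. \<Sum>y\<in>A. H x y) = (\<Sum>i\<in>f ` A. \<Sum>x\<in>{x\<in>A. f x = i}. \<Sum>j\<in>f ` A. \<Sum>y\<in>{y\<in>A. f y = j}. H x y)"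
    by (simp add: sum.image_gen[OF A, of _ f])
  also have "\<dots> = (\<Sum>i\<in>f ` A. \<Sum>j\<in>f ` A. \<Sum>x\<in>{x\<in>A. f x = i}. \<Sum>y\<in>{y\<in>A. f y = j}. H x y)"
    by (rule sum.cong[OF refl], rule sum.swap)
  also have "\<dots> = (\<Sum>i\<in>f ` A. (\<Sum>x\<in>{x\<in>A. f x = i}. \<Sum>y\<in>{y\<in>A. f y = i}. H x y) +
     (\<Sum>j\<in>f ` A - {i}. \<Sum>x\<in>{x\<in>A. f x = i}. \<Sum>y\<in>{y\<in>A. f y = j}. H x y))"
    using A by (intro sum.cong refl sum.remove) auto
  finally show ?thesis by (simp add: sum.distrib)
qed

text \<open>A pair inside a row contributes the stabiliser sum itself. For two different rows, the
  transfer relation into the longer one gives minus that sum for each element of the shorter one,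
  hence the minimum of the two lengths in total.\<close>

lemma all_transpositions_stab_sum:
  fixes \<mu> :: "'a \<Rightarrow> 'b"
  assumes A: "finite A" and g: "g permutes A"
    and van: "\<And>(\<nu> :: 'a \<Rightarrow> 'b) g. potential A \<nu> > potential A \<mu> \<Longrightarrow> g permutes A \<Longrightarrow> stab_sum A \<nu> F g = 0"
  shows "all_transpositions A (stab_sum A \<mu> F) g = (same_label A \<mu> - min_overlap A \<mu>) * stab_sum A \<mu> F g"
proof -
  let ?w = "stab_sum A \<mu> F" and ?N = "\<lambda>l. {x\<in>A. \<mu> x = l}"
  have same: "?w (g \<circ> transpose x y) = ?w g" if "x \<in> A" "y \<in> A" "\<mu> x = \<mu> y" for x y
    by (rule stab_sum_invariant[OF transpose_stab[OF that]])
  have half: "(\<Sum>x\<in>?N l. \<Sum>y\<in>?N l'. ?w (g \<circ> transpose x y)) = - int (card (?N l')) * ?w g"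
    if "l \<noteq> l'" "card (?N l') \<le> card (?N l)" for l l'
  proof -
    have "(\<Sum>x\<in>?N l. \<Sum>y\<in>?N l'. ?w (g \<circ> transpose x y)) = (\<Sum>y\<in>?N l'. \<Sum>x\<in>?N l. ?w (g \<circ> transpose x y))"
      by (rule sum.swap)
    also have "\<dots> = (\<Sum>y\<in>?N l'. - ?w g)"
      by (rule sum.cong[OF refl], rule stab_sum_transfer[OF A g _ _ van]) (use that in auto)
    finally show ?thesis by simp
  qed
  have diff: "(\<Sum>x\<in>?N l. \<Sum>y\<in>?N l'. ?w (g \<circ> transpose x y)) = - int (min (card (?N l)) (card (?N l'))) * ?w g"
    if "l \<noteq> l'" for l l'
  proof (cases "card (?N l') \<le> card (?N l)")
    case True
    then show ?thesis using half[OF that] by (simp add: min_def)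
  next
    case False
    have "(\<Sum>x\<in>?N l. \<Sum>y\<in>?N l'. ?w (g \<circ> transpose x y)) = (\<Sum>y\<in>?N l'. \<Sum>x\<in>?N l. ?w (g \<circ> transpose y x))"
      by (subst sum.swap) (simp add: transpose_commute)
    then show ?thesis using half[of l' l] that False by (simp add: min_def)
  qed
  have "all_transpositions A ?w g =
    (\<Sum>i\<in>\<mu> ` A. \<Sum>x\<in>?N i. \<Sum>y\<in>?N i. ?w g) +
    (\<Sum>i\<in>\<mu> ` A. \<Sum>j\<in>\<mu> ` A - {i}. - int (min (card (?N i)) (card (?N j))) * ?w g)"
    unfolding all_transpositions_def sum_by_fibres[OF A, of _ \<mu>]
    by (intro arg_cong2[of _ _ _ _ "(+)"] sum.cong refl same diff) auto
  also have "(\<Sum>i\<in>\<mu> ` A. \<Sum>x\<in>?N i. \<Sum>y\<in>?N i. ?w g) = same_label A \<mu> * ?w g"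
  proof -
    have "same_label A \<mu> = (\<Sum>i\<in>\<mu> ` A. \<Sum>x\<in>?N i. \<Sum>y\<in>?N i. 1) + (\<Sum>i\<in>\<mu> ` A. \<Sum>j\<in>\<mu> ` A - {i}. \<Sum>x\<in>?N i. \<Sum>y\<in>?N j. 0)"
      unfolding same_label_def sum_by_fibres[OF A, of _ \<mu>]
      by (intro arg_cong2[of _ _ _ _ "(+)"] sum.cong refl) auto
    then show ?thesis by (simp add: sum_distrib_right mult.assoc)
  qed
  also have "(\<Sum>i\<in>\<mu> ` A. \<Sum>j\<in>\<mu> ` A - {i}. - int (min (card (?N i)) (card (?N j))) * ?w g) = - min_overlap A \<mu> * ?w g"
    by (simp add: min_overlap_def sum_distrib_right sum_negf)
  finally show ?thesis by (simp add: algebra_simps)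
qed

text \<open>On a fibre of \<open>f\<close> the map \<open>g\<close> is injective, so equal
  \<open>g\<close>-labels occur there only on the diagonal, which accounts for
  \<open>card A\<close>. Two different fibres contribute the number of labels that they
  share.\<close>

lemma same_label_overlap:
  assumes A: "finite A" and inj: "inj_on (\<lambda>x. (f x, g x)) A"
  shows "same_label A g = int (card A) +
    (\<Sum>i\<in>f ` A. \<Sum>j\<in>f ` A - {i}. int (card (g ` {x\<in>A. f x = i} \<inter> g ` {x\<in>A. f x = j})))"
proof -
  have inj': "inj_on g {x\<in>A. f x = i}" for i using inj by (auto simp: inj_on_def)
  have *: "(\<Sum>x\<in>D. \<Sum>y\<in>E. of_bool (g x = g y)) = int (card (g ` D \<inter> g ` E))"
    if "finite D" "finite E" "inj_on g D" "inj_on g E" for D E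
  proof -
    have "(\<Sum>x\<in>D. \<Sum>y\<in>E. of_bool (g x = g y)) = (\<Sum>u\<in>g ` D. \<Sum>v\<in>g ` E. of_bool (u = v) :: int)"
      using that by (simp only: sum.reindex o_def)
    also have "\<dots> = (\<Sum>u\<in>g ` D. of_bool (u \<in> g ` E))"
      using that by (intro sum.cong refl) (simp add: of_bool_def sum.delta)
    also have "\<dots> = int (card (g ` D \<inter> g ` E))"
      using that by (simp add: of_bool_def sum.If_cases Int_def)
    finally show ?thesis .
  qed
  have fib: "(\<Sum>x\<in>{x\<in>A. f x = i}. \<Sum>y\<in>{y\<in>A. f y = j}. of_bool (g x = g y)) =
      int (card (g ` {x\<in>A. f x = i} \<inter> g ` {x\<in>A. f x = j}))" for i j
    using A by (intro * inj') auto
  have "same_label A g = (\<Sum>i\<in>f ` A. int (card {x\<in>A. f x = i})) +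
    (\<Sum>i\<in>f ` A. \<Sum>j\<in>f ` A - {i}. int (card (g ` {x\<in>A. f x = i} \<inter> g ` {x\<in>A. f x = j})))"
    unfolding same_label_def sum_by_fibres[OF A, of _ f]
    by (simp only: fib Int_absorb card_image[OF inj'])
  also have "(\<Sum>i\<in>f ` A. int (card {x\<in>A. f x = i})) = int (card A)"
    using sum.image_gen[OF A, of "\<lambda>_. 1::int" f] by simp
  finally show ?thesis .
qed

lemma card_Int_le_min: "finite S \<Longrightarrow> finite T \<Longrightarrow> card (S \<inter> T) \<le> min (card S) (card T)"
  by (auto intro: card_mono)

lemma card_fibre_image_le:
  assumes A: "finite A" and inj: "inj_on (\<lambda>x. (f x, g x)) A"
  shows "card (g ` {x\<in>A. f x = i} \<inter> g ` {x\<in>A. f x = j}) \<le> min (card {x\<in>A. f x = i}) (card {x\<in>A. f x = j})"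
proof -
  have inj': "inj_on g {x\<in>A. f x = i}" for i using inj by (auto simp: inj_on_def)
  show ?thesis
    using card_Int_le_min[of "g ` {x\<in>A. f x = i}" "g ` {x\<in>A. f x = j}"] A by (simp add: card_image[OF inj'])
qed

lemma same_label_le:
  assumes A: "finite A" and inj: "inj_on (\<lambda>x. (f x, g x)) A"
  shows "same_label A g \<le> int (card A) + min_overlap A f"
  unfolding same_label_overlap[OF assms] min_overlap_def
  using card_fibre_image_le[OF assms] by (intro add_left_mono sum_mono) simp

text \<open>Each number of shared labels is at most the smaller fibre size, so equality of the
  totals leaves no slack in any single term.\<close>

lemma same_label_eqD:
  assumes A: "finite A" and inj: "inj_on (\<lambda>x. (f x, g x)) A"
    and eq: "same_label A g = int (card A) + min_overlap A f"
    and ij: "i \<in> f ` A" "j \<in> f ` A" "i \<noteq> j"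
  shows "card (g ` {x\<in>A. f x = i} \<inter> g ` {x\<in>A. f x = j}) = min (card {x\<in>A. f x = i}) (card {x\<in>A. f x = j})"
proof (rule ccontr)
  let ?a = "\<lambda>i j. int (card (g ` {x\<in>A. f x = i} \<inter> g ` {x\<in>A. f x = j}))"
  let ?b = "\<lambda>i j. int (min (card {x\<in>A. f x = i}) (card {x\<in>A. f x = j}))"
  have le: "?a i j \<le> ?b i j" for i j using card_fibre_image_le[OF A inj] by simp
  assume "\<not> ?thesis"
  then have "?a i j \<noteq> ?b i j" by (simp only: of_nat_eq_iff not_False_eq_True)
  with le[of i j] have lt: "?a i j < ?b i j" by linarith
  have "(\<Sum>j\<in>f ` A - {i}. ?a i j) < (\<Sum>j\<in>f ` A - {i}. ?b i j)"
    by (rule sum_strict_mono_ex1) (use A le lt ij in auto)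
  moreover have "(\<Sum>j\<in>f ` A - {i}. ?a i j) \<le> (\<Sum>j\<in>f ` A - {i}. ?b i j)" for i
    by (intro sum_mono le)
  ultimately have "(\<Sum>i\<in>f ` A. \<Sum>j\<in>f ` A - {i}. ?a i j) < (\<Sum>i\<in>f ` A. \<Sum>j\<in>f ` A - {i}. ?b i j)"
    by (intro sum_strict_mono_ex1) (use A ij in auto)
  then show False using eq unfolding same_label_overlap[OF A inj] min_overlap_def by simp
qed

text \<open>The enumeration grows by appending the new elements of each set. It will number the rows
  so that every column meets an initial segment of them.\<close>

lemma ex_chain_enumeration:
  assumes "\<And>i. i \<le> n \<Longrightarrow> finite (S i)" "\<And>i. i < n \<Longrightarrow> S i \<subseteq> S (Suc i)"
  shows "\<exists>\<pi>::nat \<Rightarrow> 'b. inj_on \<pi> {1..card (S n)} \<and> (\<forall>i\<le>n. \<pi> ` {1..card (S i)} = S i)"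
  using assms
proof (induction n)
  case 0
  then obtain \<pi> where "bij_betw \<pi> {1..card (S 0)} (S 0)"
    using ex_bij_betw_nat_finite_1[of "S 0"] by auto
  then show ?case by (auto simp: bij_betw_def)
next
  case (Suc n)
  then obtain \<pi> where \<pi>: "inj_on \<pi> {1..card (S n)}" "\<And>i. i \<le> n \<Longrightarrow> \<pi> ` {1..card (S i)} = S i"
    by (metis le_SucI less_SucI)
  let ?D = "{Suc (card (S n))..card (S (Suc n))}" and ?E = "S (Suc n) - S n"
  have sub: "S n \<subseteq> S (Suc n)" "finite (S (Suc n))" using Suc.prems by auto
  have *: "i + d \<le> n \<Longrightarrow> S i \<subseteq> S (i + d)" for i d
  proof (induction d)
    case (Suc d)
    then show ?case using Suc.prems \<open>\<And>i. i < Suc n \<Longrightarrow> S i \<subseteq> S (Suc i)\<close>[of "i + d"] by simp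
  qed simp
  have chain: "S i \<subseteq> S n" if "i \<le> n" for i using *[of i "n - i"] that by simp
  have "card ?D = card ?E" using sub by (simp add: card_Diff_subset finite_subset)
  then obtain \<sigma> where \<sigma>: "bij_betw \<sigma> ?D ?E"
    using sub finite_same_card_bij[of ?D ?E] by auto
  have le: "card (S n) \<le> card (S (Suc n))" using sub by (simp add: card_mono)
  define \<pi>' where "\<pi>' i = (if i \<le> card (S n) then \<pi> i else \<sigma> i)" for i
  have old: "\<pi>' ` {1..card (S i)} = S i" if "i \<le> n" for i
  proof -
    have "card (S i) \<le> card (S n)" using chain[OF that] Suc.prems by (intro card_mono) auto
    then have "\<pi>' ` {1..card (S i)} = \<pi> ` {1..card (S i)}" by (intro image_cong) (auto simp: \<pi>'_def)
    then show ?thesis using \<pi>(2)[OF that] by simp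
  qed
  have new: "\<pi>' ` ?D = ?E" using \<sigma> by (auto simp: \<pi>'_def bij_betw_def)
  have split: "{1..card (S (Suc n))} = {1..card (S n)} \<union> ?D" using le by auto
  have img: "\<pi>' ` {1..card (S (Suc n))} = S (Suc n)"
    unfolding split image_Un new old[OF order_refl] using sub by auto
  then have "inj_on \<pi>' {1..card (S (Suc n))}" by (intro eq_card_imp_inj_on) auto
  then show ?case using old img by (auto simp: le_Suc_eq intro!: exI[of _ \<pi>'])
qed

section \<open>Alternating functions on a Young diagram\<close>

lemma stab_cong: "(\<And>x. x \<in> A \<Longrightarrow> \<mu> x = \<nu> x) \<Longrightarrow> stab A \<mu> = stab A \<nu>"
  by (auto simp: stab_def permutes_in_image)

lemma stab_inj_comp:
  assumes "inj_on \<pi> (\<mu> ` A)"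
  shows "stab A (\<pi> \<circ> \<mu>) = stab A \<mu>"
  using assms by (auto simp: stab_def permutes_in_image inj_on_eq_iff)

lemma sign_mult_self: "sign p * (sign p * x) = (x::int)"
  by (simp add: sign_def)

text \<open>Conjugating the group of \<open>\<mu>\<close> by \<open>\<tau>\<close> leaves a trailing
  \<open>inv \<tau>\<close>, which the alternating property turns into a sign.\<close>

lemma stab_sum_alternating:
  assumes A: "finite A" and F: "alternating A f F" and \<tau>: "\<tau> \<in> stab A f" and h: "h permutes A"
  shows "stab_sum A \<mu> F h = sign \<tau> * stab_sum A (\<mu> \<circ> \<tau>) F (h \<circ> \<tau>)"
proof -
  note \<tau>p = stabD(1)[OF \<tau>]
  have sgn: "sign (inv \<tau>) = sign \<tau>" using permutes_imp_permutation[OF A \<tau>p] by (rule sign_inverse)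
  have "stab_sum A \<mu> F h = (\<Sum>\<rho>\<in>stab A (\<mu> \<circ> \<tau>). F (h \<circ> \<tau> \<circ> \<rho> \<circ> inv \<tau>))"
    unfolding stab_sum_def using sum_stab_conj[OF \<tau>p, where \<mu> = \<mu> and H = "\<lambda>\<rho>. F (h \<circ> \<rho>)"]
    by (simp add: comp_assoc)
  also have "\<dots> = (\<Sum>\<rho>\<in>stab A (\<mu> \<circ> \<tau>). sign \<tau> * F (h \<circ> \<tau> \<circ> \<rho>))"
  proof (rule sum.cong[OF refl])
    fix \<rho> assume "\<rho> \<in> stab A (\<mu> \<circ> \<tau>)"
    then have "h \<circ> \<tau> \<circ> \<rho> permutes A" using h \<tau>p by (auto dest: stabD(1) intro!: permutes_compose)
    from alternatingD[OF F this stab_inv[OF \<tau>]]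
    show "F (h \<circ> \<tau> \<circ> \<rho> \<circ> inv \<tau>) = sign \<tau> * F (h \<circ> \<tau> \<circ> \<rho>)" by (simp add: sgn)
  qed
  finally show ?thesis by (simp add: stab_sum_def sum_distrib_left)
qed

locale young_diagram =
  fixes a :: nat and c :: "nat \<Rightarrow> nat"
  assumes antitone: "1 \<le> i \<Longrightarrow> i \<le> j \<Longrightarrow> j \<le> a \<Longrightarrow> c j \<le> c i"
begin

text \<open>A cell is a pair (column, row), in the order of a symbol (number, index), so that a cell
  is the very symbol that \<open>t_lam\<close> puts there; \<open>fst\<close> is the column
  labelling and \<open>snd\<close> the row labelling.\<close>

definition cells :: "(nat \<times> nat) set" where
  "cells = {(i, j). 1 \<le> i \<and> i \<le> a \<and> 1 \<le> j \<and> j \<le> c i}"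

lemma column: "1 \<le> j \<Longrightarrow> j \<le> a \<Longrightarrow> {x \<in> cells. fst x = j} = Pair j ` {1..c j}"
  by (auto simp: cells_def)

lemma card_column: "1 \<le> j \<Longrightarrow> j \<le> a \<Longrightarrow> card {x \<in> cells. fst x = j} = c j"
  by (simp add: column card_image inj_on_def)

lemma finite_cells: "finite cells"
proof -
  have "cells = Sigma {1..a} (\<lambda>j. {1..c j})" by (auto simp: cells_def)
  then show ?thesis by simp
qed

lemma columns: "fst ` cells = {j. 1 \<le> j \<and> j \<le> a \<and> 0 < c j}"
  by (force simp: cells_def image_iff)

lemma min_overlap_columns:
  "min_overlap cells fst = (\<Sum>i\<in>fst ` cells. \<Sum>j\<in>fst ` cells - {i}. int (min (c i) (c j)))"
  unfolding min_overlap_def by (intro sum.cong refl) (auto simp: columns card_column)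

text \<open>Equality in the double count makes two columns share as many labels as the shorter one
  has, and the later column is the shorter one.\<close>

lemma columns_nested:
  assumes inj: "inj_on (\<lambda>x. (fst x, \<mu> x)) cells"
    and eq: "same_label cells \<mu> = int (card cells) + min_overlap cells fst"
    and ij: "1 \<le> i" "i \<le> j" "j \<le> a"
  shows "\<mu> ` {x \<in> cells. fst x = j} \<subseteq> \<mu> ` {x \<in> cells. fst x = i}"
proof (cases "i = j \<or> c j = 0")
  case True
  then show ?thesis using ij by (auto simp: cells_def)
next
  case False
  let ?S = "\<lambda>j. \<mu> ` {x \<in> cells. fst x = j}"
  have inj': "inj_on \<mu> {x \<in> cells. fst x = i}" for i using inj by (auto simp: inj_on_def)
  have le: "c j \<le> c i" using antitone ij by simp
  have "card (?S i \<inter> ?S j) = min (card {x \<in> cells. fst x = i}) (card {x \<in> cells. fst x = j})"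
    using same_label_eqD[OF finite_cells inj eq, of i j] False ij le by (simp add: columns)
  also have "\<dots> = card (?S j)" using ij le by (simp add: card_column card_image[OF inj'])
  finally have "?S i \<inter> ?S j = ?S j"
    using finite_cells by (intro card_seteq) auto
  then show ?thesis by blast
qed

text \<open>Counting shows that \<open>\<pi>\<close> is injective on \<open>{1..c j}\<close>, so the
  cells can be rearranged inside each column separately until row \<open>r\<close> carries the label
  \<open>\<pi> r\<close>.\<close>

lemma ex_column_permutation:
  assumes inj: "inj_on (\<lambda>x. (fst x, \<mu> x)) cells"
    and \<pi>: "\<And>j. 1 \<le> j \<Longrightarrow> j \<le> a \<Longrightarrow> \<pi> ` {1..c j} = \<mu> ` {x \<in> cells. fst x = j}"
  shows "\<exists>\<tau>\<in>stab cells fst. \<forall>x\<in>cells. \<mu> (\<tau> x) = \<pi> (snd x)"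
proof -
  have inj': "inj_on \<mu> {x \<in> cells. fst x = i}" for i using inj by (auto simp: inj_on_def)
  have \<pi>_inj: "inj_on \<pi> {1..c j}" if "1 \<le> j" "j \<le> a" for j
  proof -
    have "card (\<pi> ` {1..c j}) = card {1..c j}"
      unfolding \<pi>[OF that] using that by (simp add: card_image[OF inj'] card_column)
    then show ?thesis by (intro eq_card_imp_inj_on) auto
  qed
  have "\<exists>y. y \<in> cells \<and> fst y = fst x \<and> \<mu> y = \<pi> (snd x)" if "x \<in> cells" for x
  proof -
    have "1 \<le> fst x" "fst x \<le> a" "snd x \<in> {1..c (fst x)}" using that by (auto simp: cells_def)
    then have "\<pi> (snd x) \<in> \<mu> ` {y \<in> cells. fst y = fst x}" using \<pi>[of "fst x"] by blast
    then show ?thesis by auto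
  qed
  then obtain t where t: "\<And>x. x \<in> cells \<Longrightarrow> t x \<in> cells \<and> fst (t x) = fst x \<and> \<mu> (t x) = \<pi> (snd x)"
    by metis
  define \<tau> where "\<tau> x = (if x \<in> cells then t x else x)" for x
  have "inj_on \<tau> cells"
  proof (rule inj_onI)
    fix x y assume xy: "x \<in> cells" "y \<in> cells" "\<tau> x = \<tau> y"
    then have "fst x = fst y" "\<pi> (snd x) = \<pi> (snd y)" using t[of x] t[of y] by (auto simp: \<tau>_def)
    moreover have "snd x = snd y"
      by (rule inj_onD[OF \<pi>_inj[of "fst x"]]) (use calculation xy in \<open>auto simp: cells_def\<close>)
    ultimately show "x = y" by (simp add: prod_eq_iff)
  qed
  moreover have "\<tau> ` cells \<subseteq> cells" using t by (auto simp: \<tau>_def)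
  ultimately have "bij_betw \<tau> cells cells"
    using finite_cells by (simp add: bij_betw_def endo_inj_surj)
  then have "\<tau> permutes cells" by (rule bij_imp_permutes) (simp add: \<tau>_def)
  then have "\<tau> \<in> stab cells fst" using t by (auto simp: stab_def \<tau>_def)
  then show ?thesis using t by (intro bexI[of _ \<tau>]) (simp_all add: \<tau>_def)
qed

text \<open>Column \<open>j\<close> meets exactly the rows \<open>1\<close> to \<open>c j\<close>,
  so the row labelling of the diagram attains the bound of the double count.\<close>

lemma same_label_snd: "same_label cells snd = int (card cells) + min_overlap cells fst"
proof -
  have inj: "inj_on (\<lambda>x. (fst x, snd x)) cells" by (auto simp: inj_on_def)
  have "snd ` {x \<in> cells. fst x = j} = {1..c j}" if "j \<in> fst ` cells" for j
    using that by (auto simp: columns column image_image)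
  then show ?thesis
    unfolding same_label_overlap[OF finite_cells inj] min_overlap_columns
    by (auto intro!: sum.cong simp: min.commute)
qed

lemma same_label_permute:
  assumes k: "k permutes cells"
  shows "same_label cells (\<mu> \<circ> k) = same_label cells \<mu>"
proof -
  have "same_label cells \<mu> = (\<Sum>x\<in>cells. \<Sum>y\<in>cells. of_bool (\<mu> (k x) = \<mu> y))"
    unfolding same_label_def
    using sum.permute[OF k, of "\<lambda>x. \<Sum>y\<in>cells. of_bool (\<mu> x = \<mu> y)"] by (simp add: o_def)
  also have "\<dots> = same_label cells (\<mu> \<circ> k)"
    unfolding same_label_def o_def
  proof (rule sum.cong[OF refl])
    fix x
    show "(\<Sum>y\<in>cells. of_bool (\<mu> (k x) = \<mu> y)) = (\<Sum>y\<in>cells. of_bool (\<mu> (k x) = \<mu> (k y)))"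
      using sum.permute[OF k, of "\<lambda>y. of_bool (\<mu> (k x) = \<mu> y)"] by (simp only: o_def)
  qed
  finally show ?thesis by simp
qed

text \<open>The labelling \<open>snd \<circ> k\<close> has the row lengths of the diagram and no
  repetition in a column. It therefore attains the bound, its columns are nested, and the labels in
  column \<open>j\<close> turn out to be \<open>{1..c j}\<close>; it remains to sort each
  column.\<close>

lemma straighten_columns:
  assumes k: "k permutes cells" and inj: "inj_on (\<lambda>x. (fst x, snd (k x))) cells"
  shows "\<exists>\<tau>\<in>stab cells fst. \<forall>x\<in>cells. snd (k (\<tau> x)) = snd x"
proof -
  define \<mu> where "\<mu> = snd \<circ> k"
  have inj: "inj_on (\<lambda>x. (fst x, \<mu> x)) cells" using inj by (simp add: \<mu>_def)
  have inj': "inj_on \<mu> {x \<in> cells. fst x = i}" for i using inj by (auto simp: inj_on_def)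
  have eq: "same_label cells \<mu> = int (card cells) + min_overlap cells fst"
    unfolding \<mu>_def same_label_permute[OF k] by (rule same_label_snd)
  have "id ` {1..c j} = \<mu> ` {x \<in> cells. fst x = j}" if j: "1 \<le> j" "j \<le> a" for j
  proof -
    have "\<mu> ` {x \<in> cells. fst x = j} \<subseteq> {1..c j}"
    proof
      fix l assume l: "l \<in> \<mu> ` {x \<in> cells. fst x = j}"
      then obtain x where "x \<in> cells" "l = snd (k x)" by (auto simp: \<mu>_def)
      then have l1: "1 \<le> l" using permutes_in_image[OF k, of x] by (auto simp: cells_def)
      \<comment> \<open>A label of column \<open>j\<close> occurs in all earlier columns too, so row
        \<open>l\<close> of the diagram has at least \<open>j\<close> cells. This forces
        \<open>l \<le> c j\<close>.\<close>
      have "{1..j} \<subseteq> fst ` {y \<in> cells. \<mu> y = l}"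
      proof
        fix i assume "i \<in> {1..j}"
        then have "l \<in> \<mu> ` {x \<in> cells. fst x = i}" using columns_nested[OF inj eq, of i j] l j by auto
        then show "i \<in> fst ` {y \<in> cells. \<mu> y = l}" by auto
      qed
      then have "j \<le> card (fst ` {y \<in> cells. \<mu> y = l})"
        using card_mono[of "fst ` {y \<in> cells. \<mu> y = l}" "{1..j}"] finite_cells by auto
      also have "\<dots> \<le> card {y \<in> cells. \<mu> y = l}" using finite_cells by (intro card_image_le) auto
      also have "\<dots> = card {y \<in> cells. snd y = l}"
      proof (rule bij_betw_same_card[of k])
        show "bij_betw k {y \<in> cells. \<mu> y = l} {y \<in> cells. snd y = l}"
          by (rule bij_betw_byWitness[of _ "inv k"])
             (auto simp: \<mu>_def permutes_inverses[OF k] permutes_in_image[OF k] permutes_in_image[OF permutes_inv[OF k]])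
      qed
      finally have le: "j \<le> card {y \<in> cells. snd y = l}" .
      show "l \<in> {1..c j}"
      proof (rule ccontr)
        assume "l \<notin> {1..c j}"
        then have cl: "c j < l" using l1 by auto
        have "{y \<in> cells. snd y = l} \<subseteq> (\<lambda>i. (i, l)) ` {1..<j}"
        proof
          fix y assume y: "y \<in> {y \<in> cells. snd y = l}"
          have "\<not> j \<le> fst y"
          proof
            assume "j \<le> fst y"
            then have "c (fst y) \<le> c j" using y j antitone[of j "fst y"] by (auto simp: cells_def)
            then show False using y cl by (auto simp: cells_def)
          qed
          then show "y \<in> (\<lambda>i. (i, l)) ` {1..<j}" using y by (cases y) (auto simp: cells_def)
        qed
        then have "card {y \<in> cells. snd y = l} \<le> card ((\<lambda>i. (i, l)) ` {1..<j})" by (intro card_mono) auto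
        also have "\<dots> \<le> j - 1" using card_image_le[of "{1..<j}" "\<lambda>i. (i, l)"] by simp
        finally show False using le j by simp
      qed
    qed
    moreover have "card (\<mu> ` {x \<in> cells. fst x = j}) = card {1..c j}"
      using j by (simp add: card_image[OF inj'] card_column)
    ultimately have "\<mu> ` {x \<in> cells. fst x = j} = {1..c j}" by (intro card_subset_eq) auto
    then show ?thesis by simp
  qed
  from ex_column_permutation[OF inj this] show ?thesis by (simp add: \<mu>_def)
qed

text \<open>The coefficient of the tabloid \<open>{t_lam} k\<close> in the polytabloid of
  \<open>t_lam\<close>, expressed without tabloids: the condition says that
  \<open>{t_lam} \<tau>\<close> and \<open>{t_lam} k\<close> have the same rows.\<close>

definition eps :: "(nat \<times> nat \<Rightarrow> nat \<times> nat) \<Rightarrow> int" where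
  "eps k = (\<Sum>\<tau>\<in>stab cells fst. if \<forall>x\<in>cells. snd (inv \<tau> x) = snd (inv k x) then sign \<tau> else 0)"

text \<open>A column permutation is determined by the rows to which it sends the cells, so
  \<open>\<tau>\<close> is the only one that contributes.\<close>

lemma eps_inv:
  assumes k: "k permutes cells" and \<tau>: "\<tau> \<in> stab cells fst" and eq: "\<And>x. x \<in> cells \<Longrightarrow> snd (k (\<tau> x)) = snd x"
  shows "eps (inv k) = sign \<tau>"
proof -
  note \<tau>p = stabD(1)[OF \<tau>]
  have "(\<forall>x\<in>cells. snd (inv \<sigma> x) = snd (inv (inv k) x)) \<longleftrightarrow> \<sigma> = \<tau>" if \<sigma>: "\<sigma> \<in> stab cells fst" for \<sigma>
  proof
    note \<sigma>p = stabD(1)[OF \<sigma>]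
    assume *: "\<forall>x\<in>cells. snd (inv \<sigma> x) = snd (inv (inv k) x)"
    have "inv \<sigma> (\<tau> x) = x" if x: "x \<in> cells" for x
    proof -
      have \<tau>x: "\<tau> x \<in> cells" using x permutes_in_image[OF \<tau>p] by simp
      have "snd (inv \<sigma> (\<tau> x)) = snd x"
        using * \<tau>x eq[OF x] by (simp add: permutes_inv_inv[OF k])
      moreover have "fst (inv \<sigma> (\<tau> x)) = fst x"
        using stabD(2)[OF stab_inv[OF \<sigma>] \<tau>x] stabD(2)[OF \<tau> x] by simp
      ultimately show ?thesis by (simp add: prod_eq_iff)
    qed
    then have "\<sigma> x = \<tau> x" if "x \<in> cells" for x using that permutes_inverses[OF \<sigma>p] by metis
    moreover have "\<sigma> x = \<tau> x" if "x \<notin> cells" for x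
      using that permutes_not_in[OF \<sigma>p] permutes_not_in[OF \<tau>p] by simp
    ultimately show "\<sigma> = \<tau>" by blast
  next
    assume [simp]: "\<sigma> = \<tau>"
    show "\<forall>x\<in>cells. snd (inv \<sigma> x) = snd (inv (inv k) x)"
    proof
      fix x assume "x \<in> cells"
      then have "inv \<tau> x \<in> cells" using permutes_in_image[OF permutes_inv[OF \<tau>p]] by simp
      from eq[OF this] show "snd (inv \<sigma> x) = snd (inv (inv k) x)"
        by (simp add: permutes_inverses[OF \<tau>p] permutes_inv_inv[OF k])
    qed
  qed
  then have "eps (inv k) = (\<Sum>\<sigma>\<in>stab cells fst. if \<sigma> = \<tau> then sign \<sigma> else 0)"
    unfolding eps_def by (intro sum.cong) auto
  also have "\<dots> = sign \<tau>" using \<tau> by (simp add: sum.delta[OF finite_stab[OF finite_cells]])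
  finally show ?thesis .
qed

lemma eps_id: "eps id = 1"
  using eps_inv[of id id] by (simp add: id_stab permutes_id sign_id)

text \<open>The analogue of von Neumann's lemma: either \<open>k\<close> is a row times a column permutation, or two cells
  of one column are sent to the same row.\<close>

lemma sum_rows_translate:
  assumes F: "alternating cells fst F" and g: "g permutes cells" and k: "k permutes cells"
  shows "(\<Sum>\<rho>\<in>stab cells snd. F (g \<circ> \<rho> \<circ> k)) = eps (inv k) * stab_sum cells snd F g"
proof (cases "inj_on (\<lambda>x. (fst x, snd (k x))) cells")
  case True
  then obtain \<tau> where \<tau>: "\<tau> \<in> stab cells fst" "\<And>x. x \<in> cells \<Longrightarrow> snd (k (\<tau> x)) = snd x"
    using straighten_columns[OF k] by blast
  note \<tau>p = stabD(1)[OF \<tau>(1)]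
  have gk: "g \<circ> k permutes cells" using g k by (intro permutes_compose)
  have st: "stab cells (snd \<circ> k \<circ> \<tau>) = stab cells snd" using \<tau>(2) by (intro stab_cong) simp
  \<comment> \<open>The factorisation into a row and a column permutation is
    \<open>k = (k \<circ> \<tau>) \<circ> inv \<tau>\<close>.\<close>
  have mem: "k \<circ> \<tau> \<in> stab cells snd" using \<tau>(2) permutes_compose[OF \<tau>p k] by (simp add: stab_def)
  have "(\<Sum>\<rho>\<in>stab cells snd. F (g \<circ> \<rho> \<circ> k)) = sign \<tau> * stab_sum cells (snd \<circ> k \<circ> \<tau>) F (g \<circ> k \<circ> \<tau>)"
    unfolding stab_sum_translate[OF k] by (rule stab_sum_alternating[OF finite_cells F \<tau>(1) gk])
  also have "stab_sum cells (snd \<circ> k \<circ> \<tau>) F (g \<circ> k \<circ> \<tau>) = stab_sum cells snd F (g \<circ> (k \<circ> \<tau>))"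
    unfolding stab_sum_def st by (simp add: comp_assoc)
  also have "\<dots> = stab_sum cells snd F g" by (rule stab_sum_invariant[OF mem])
  also have "sign \<tau> = eps (inv k)" using eps_inv[OF k \<tau>] by simp
  finally show ?thesis .
next
  case False
  then obtain p q where pq: "p \<in> cells" "q \<in> cells" "p \<noteq> q" "fst p = fst q" "snd (k p) = snd (k q)"
    by (auto simp: inj_on_def)
  have "(\<Sum>\<rho>\<in>stab cells snd. F (g \<circ> \<rho> \<circ> k)) = 0"
    unfolding stab_sum_translate[OF k]
    by (rule stab_sum_eq_0[OF F permutes_compose[OF k g] pq(1-4)]) (simp add: pq)
  moreover have "\<not> (\<forall>x\<in>cells. snd (inv \<tau> x) = snd (inv (inv k) x))" if \<tau>: "\<tau> \<in> stab cells fst" for \<tau>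
  proof
    assume "\<forall>x\<in>cells. snd (inv \<tau> x) = snd (inv (inv k) x)"
    then have "snd (inv \<tau> p) = snd (inv \<tau> q)" using pq by (simp add: permutes_inv_inv[OF k])
    moreover have "fst (inv \<tau> p) = fst (inv \<tau> q)" using stabD(2)[OF stab_inv[OF \<tau>]] pq by simp
    ultimately have "inv \<tau> p = inv \<tau> q" by (simp add: prod_eq_iff)
    then show False using pq(3) permutes_inverses(1)[OF stabD(1)[OF \<tau>]] by metis
  qed
  then have "eps (inv k) = 0" unfolding eps_def by (intro sum.neutral) auto
  ultimately show ?thesis by simp
qed

text \<open>The eigenvalue of the sum over all ordered pairs: \<open>card cells\<close> plus twice the sum of the contents.\<close>

definition eigenvalue :: int where
  "eigenvalue = 2 * int (card cells) - same_label cells fst + min_overlap cells fst"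

text \<open>Stated for an arbitrary function, so that it applies both to \<open>v\<close> and to the
  difference \<open>v r b - \<kappa> v\<close>.\<close>

definition specht_like :: "((nat \<times> nat \<Rightarrow> nat \<times> nat) \<Rightarrow> int) \<Rightarrow> bool" where
  "specht_like F \<longleftrightarrow> alternating cells fst F \<and>
    (\<forall>g. g permutes cells \<longrightarrow> all_transpositions cells F g = eigenvalue * F g)"

text \<open>Take a labelling of maximal potential among those with a nonvanishing stabiliser sum.
  Its transposition scalar must equal \<open>eigenvalue\<close>, which leaves no slack in two double
  counts. The labelling is then the row labelling up to a column permutation and a renaming of rows,
  contrary to the vanishing of the row sums.\<close>

lemma specht_like_eq_0:
  assumes F: "specht_like F" and zero: "\<And>g. g permutes cells \<Longrightarrow> stab_sum cells snd F g = 0"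
    and g: "g permutes cells"
  shows "F g = 0"
proof (rule ccontr)
  assume nz: "F g \<noteq> 0"
  have alt: "alternating cells fst F" and eig: "\<And>g. g permutes cells \<Longrightarrow> all_transpositions cells F g = eigenvalue * F g"
    using F by (auto simp: specht_like_def)
  define nonzero where "nonzero \<mu> \<longleftrightarrow> (\<exists>g. g permutes cells \<and> stab_sum cells \<mu> F g \<noteq> 0)" for \<mu> :: "nat \<times> nat \<Rightarrow> nat"
  \<comment> \<open>An injective labelling has rows of length one and stabiliser sum
    \<open>F\<close> itself, so the labellings to maximise over exist.\<close>
  have "stab cells prod_encode = {id}"
  proof -
    have "\<rho> = id" if "\<rho> \<in> stab cells prod_encode" for \<rho>
    proof
      fix x show "\<rho> x = id x"
      proof (cases "x \<in> cells")
        case True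
        from stabD(2)[OF that True] show ?thesis using injD[OF inj_prod_encode[of UNIV]] by simp
      next
        case False
        then show ?thesis using permutes_not_in[OF stabD(1)[OF that]] by simp
      qed
    qed
    then show ?thesis using id_stab by blast
  qed
  then have "nonzero prod_encode" using nz g by (auto simp: nonzero_def stab_sum_def)
  then have "\<exists>\<mu>. nonzero \<mu> \<and> (\<forall>\<nu>. nonzero \<nu> \<longrightarrow> potential cells \<nu> \<le> potential cells \<mu>)"
  proof (rule ex_has_greatest_nat[of nonzero prod_encode "potential cells" "Suc (card cells * card cells)"])
    show "\<forall>\<nu>. nonzero \<nu> \<longrightarrow> potential cells \<nu> < Suc (card cells * card cells)"
      by (simp add: less_Suc_eq_le potential_le[OF finite_cells])
  qed
  then obtain \<mu> where \<mu>: "nonzero \<mu>" and max: "\<And>\<nu>. nonzero \<nu> \<Longrightarrow> potential cells \<nu> \<le> potential cells \<mu>"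
    by blast
  then obtain h where h: "h permutes cells" "stab_sum cells \<mu> F h \<noteq> 0" by (auto simp: nonzero_def)
  have van: "stab_sum cells \<nu> F g = 0" if "potential cells \<nu> > potential cells \<mu>" "g permutes cells" for \<nu> :: "nat \<times> nat \<Rightarrow> nat" and g
    using max[of \<nu>] that by (force simp: nonzero_def)
  have inj: "inj_on (\<lambda>x. (fst x, \<mu> x)) cells"
  proof (rule inj_onI)
    fix p q assume "p \<in> cells" "q \<in> cells" "(fst p, \<mu> p) = (fst q, \<mu> q)"
    then show "p = q" using stab_sum_eq_0[OF alt h(1), of p q \<mu>] h(2) by auto
  qed
  have "(same_label cells \<mu> - min_overlap cells \<mu>) * stab_sum cells \<mu> F h = all_transpositions cells (stab_sum cells \<mu> F) h"
    by (rule all_transpositions_stab_sum[OF finite_cells h(1) van, symmetric])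
  also have "\<dots> = (\<Sum>\<rho>\<in>stab cells \<mu>. \<Sum>x\<in>cells. \<Sum>y\<in>cells. F (h \<circ> transpose x y \<circ> \<rho>))"
    unfolding all_transpositions_def stab_sum_def
    by (rule sum_swap3)
  also have "\<dots> = (\<Sum>\<rho>\<in>stab cells \<mu>. eigenvalue * F (h \<circ> \<rho>))"
    by (intro sum.cong refl)
       (auto simp: all_transpositions_conj dest!: stabD(1) intro!: eig permutes_compose h)
  finally have "same_label cells \<mu> - min_overlap cells \<mu> = eigenvalue"
    using h(2) by (simp add: stab_sum_def sum_distrib_left[symmetric])
  moreover have "same_label cells \<mu> \<le> int (card cells) + min_overlap cells fst"
    by (rule same_label_le[OF finite_cells inj])
  moreover have "same_label cells fst \<le> int (card cells) + min_overlap cells \<mu>"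
    using inj by (intro same_label_le[OF finite_cells]) (auto simp: inj_on_def)
  \<comment> \<open>With \<open>N = card cells\<close>, equality of the scalars says that
    \<open>N + min_overlap cells fst - same_label cells \<mu>\<close> and
    \<open>N + min_overlap cells \<mu> - same_label cells fst\<close> add up to 0. Neither is
    negative, so both are 0.\<close>
  ultimately have eq: "same_label cells \<mu> = int (card cells) + min_overlap cells fst"
    by (simp add: eigenvalue_def)
  have "\<exists>\<pi>. inj_on \<pi> (snd ` cells) \<and> (\<forall>j. 1 \<le> j \<longrightarrow> j \<le> a \<longrightarrow> \<pi> ` {1..c j} = \<mu> ` {x \<in> cells. fst x = j})"
  proof (cases "a = 0")
    case True
    have "x \<notin> cells" for x unfolding cells_def using True by (cases x) simp
    then have "inj_on id (snd ` cells)" by (simp add: inj_on_def)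
    then show ?thesis using True by (intro exI[of _ id] conjI allI impI) simp_all
  next
    case False
    \<comment> \<open>The columns are taken from the last to the first, so that their label sets
      increase.\<close>
    define S where "S i = \<mu> ` {x \<in> cells. fst x = a - i}" for i
    have inj': "inj_on \<mu> {x \<in> cells. fst x = i}" for i using inj by (auto simp: inj_on_def)
    have card_S: "card (S i) = c (a - i)" if "i \<le> a - 1" for i
      using that False by (simp add: S_def card_image[OF inj'] card_column)
    have "\<exists>\<pi>::nat \<Rightarrow> nat. inj_on \<pi> {1..card (S (a - 1))} \<and> (\<forall>i\<le>a - 1. \<pi> ` {1..card (S i)} = S i)"
    proof (rule ex_chain_enumeration)
      show "finite (S i)" for i using finite_cells by (simp add: S_def)
      show "S i \<subseteq> S (Suc i)" if "i < a - 1" for i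
        unfolding S_def by (rule columns_nested[OF inj eq]) (use that in auto)
    qed
    then obtain \<pi> :: "nat \<Rightarrow> nat" where \<pi>: "inj_on \<pi> {1..card (S (a - 1))}" "\<And>i. i \<le> a - 1 \<Longrightarrow> \<pi> ` {1..card (S i)} = S i"
      by blast
    have "snd ` cells \<subseteq> {1..c 1}"
    proof
      fix i assume "i \<in> snd ` cells"
      then obtain j where "(j, i) \<in> cells" by auto
      then show "i \<in> {1..c 1}" using antitone[of 1 j] by (auto simp: cells_def)
    qed
    then have "inj_on \<pi> (snd ` cells)" using \<pi>(1) card_S[of "a - 1"] False by (auto intro: inj_on_subset)
    moreover have "\<pi> ` {1..c j} = \<mu> ` {x \<in> cells. fst x = j}" if "1 \<le> j" "j \<le> a" for j
      using \<pi>(2)[of "a - j"] card_S[of "a - j"] that by (simp add: S_def)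
    ultimately show ?thesis by (intro exI[of _ \<pi>] conjI allI impI) simp_all
  qed
  then obtain \<pi> where \<pi>: "inj_on \<pi> (snd ` cells)"
    "\<And>j. 1 \<le> j \<Longrightarrow> j \<le> a \<Longrightarrow> \<pi> ` {1..c j} = \<mu> ` {x \<in> cells. fst x = j}"
    by blast
  obtain \<tau> where \<tau>: "\<tau> \<in> stab cells fst" "\<And>x. x \<in> cells \<Longrightarrow> \<mu> (\<tau> x) = \<pi> (snd x)"
    using ex_column_permutation[OF inj \<pi>(2)] by blast
  have "stab cells (\<mu> \<circ> \<tau>) = stab cells (\<pi> \<circ> snd)" using \<tau>(2) by (intro stab_cong) simp
  also have "\<dots> = stab cells snd" by (rule stab_inj_comp[OF \<pi>(1)])
  finally have "stab_sum cells (\<mu> \<circ> \<tau>) F (h \<circ> \<tau>) = stab_sum cells snd F (h \<circ> \<tau>)" by (simp add: stab_sum_def)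
  also have "\<dots> = 0" by (rule zero[OF permutes_compose[OF stabD(1)[OF \<tau>(1)] h(1)]])
  finally show False
    using stab_sum_alternating[OF finite_cells alt \<tau>(1) h(1), of \<mu>] h(2) by simp
qed

text \<open>The scalar \<open>\<kappa>\<close> with \<open>v r b = \<kappa> v\<close>.\<close>

definition hook :: int where
  "hook = (\<Sum>\<tau>\<in>stab cells fst. \<Sum>\<rho>\<in>stab cells snd. sign \<tau> * eps (inv (\<tau> \<circ> \<rho>)))"

lemma specht_like_alternating: "specht_like F \<Longrightarrow> alternating cells fst F"
  by (simp add: specht_like_def)

lemma all_transpositions_translate:
  assumes F: "specht_like F" and g: "g permutes cells" and k: "k permutes cells"
  shows "(\<Sum>x\<in>cells. \<Sum>y\<in>cells. F (g \<circ> transpose x y \<circ> k)) = eigenvalue * F (g \<circ> k)"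
  using F permutes_compose[OF k g] by (simp add: all_transpositions_conj[OF k] specht_like_def)

text \<open>If \<open>F\<close> belongs to \<open>x\<close>, then \<open>X\<close> belongs to
  \<open>x r b\<close>. It is again alternating and an eigenvector of the central transposition sum,
  and the analogue of von Neumann's lemma makes its row sums \<open>hook\<close> times those of
  \<open>F\<close>. The difference \<open>Y\<close> thus has vanishing row sums and is zero.\<close>

lemma column_row_sum:
  assumes F: "specht_like F" and g: "g permutes cells"
  shows "(\<Sum>\<tau>\<in>stab cells fst. sign \<tau> * stab_sum cells snd F (g \<circ> \<tau>)) = hook * F g"
proof -
  note alt = specht_like_alternating[OF F]
  define X where "X g = (\<Sum>\<tau>\<in>stab cells fst. sign \<tau> * stab_sum cells snd F (g \<circ> \<tau>))" for g
  note perm = permutes_compose[OF stabD(1)]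
  have X_alt: "X (g \<circ> \<sigma>) = sign \<sigma> * X g" if \<sigma>: "\<sigma> \<in> stab cells fst" for g \<sigma>
  proof -
    have "sign \<sigma> * X (g \<circ> \<sigma>) = (\<Sum>\<tau>\<in>stab cells fst. sign (\<sigma> \<circ> \<tau>) * stab_sum cells snd F (g \<circ> (\<sigma> \<circ> \<tau>)))"
      unfolding X_def sum_distrib_left
    proof (rule sum.cong[OF refl])
      fix \<tau> assume "\<tau> \<in> stab cells fst"
      then have "sign (\<sigma> \<circ> \<tau>) = sign \<sigma> * sign \<tau>"
        using \<sigma> by (intro sign_compose permutes_imp_permutation[OF finite_cells] stabD(1))
      then show "sign \<sigma> * (sign \<tau> * stab_sum cells snd F (g \<circ> \<sigma> \<circ> \<tau>)) = sign (\<sigma> \<circ> \<tau>) * stab_sum cells snd F (g \<circ> (\<sigma> \<circ> \<tau>))"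
        by (simp add: comp_assoc)
    qed
    also have "\<dots> = X g" unfolding X_def by (rule sum_stab_left[OF \<sigma>])
    finally show ?thesis by (metis sign_mult_self)
  qed
  have X_eig: "all_transpositions cells X g = eigenvalue * X g" if g: "g permutes cells" for g
  proof -
    have "all_transpositions cells X g = (\<Sum>\<tau>\<in>stab cells fst. \<Sum>x\<in>cells. \<Sum>y\<in>cells. \<Sum>\<rho>\<in>stab cells snd.
        sign \<tau> * F (g \<circ> transpose x y \<circ> (\<tau> \<circ> \<rho>)))"
      unfolding all_transpositions_def X_def stab_sum_def sum_distrib_left comp_assoc by (rule sum_swap3)
    also have "\<dots> = (\<Sum>\<tau>\<in>stab cells fst. sign \<tau> * (\<Sum>\<rho>\<in>stab cells snd.
        \<Sum>x\<in>cells. \<Sum>y\<in>cells. F (g \<circ> transpose x y \<circ> (\<tau> \<circ> \<rho>))))"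
      unfolding sum_distrib_left by (rule sum.cong[OF refl], rule sum_swap3)
    also have "\<dots> = (\<Sum>\<tau>\<in>stab cells fst. sign \<tau> * (\<Sum>\<rho>\<in>stab cells snd. eigenvalue * F (g \<circ> (\<tau> \<circ> \<rho>))))"
      by (intro sum.cong refl arg_cong2[of _ _ _ _ "(*)"] all_transpositions_translate F g perm) (auto dest: stabD(1))
    also have "\<dots> = eigenvalue * X g"
      by (simp add: X_def stab_sum_def sum_distrib_left comp_assoc mult.left_commute)
    finally show ?thesis .
  qed
  have X_rows: "stab_sum cells snd X g = hook * stab_sum cells snd F g" if g: "g permutes cells" for g
  proof -
    have "stab_sum cells snd X g = (\<Sum>\<tau>\<in>stab cells fst. \<Sum>\<rho>\<in>stab cells snd. sign \<tau> *
        (\<Sum>\<rho>'\<in>stab cells snd. F (g \<circ> \<rho>' \<circ> (\<tau> \<circ> \<rho>))))"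
      unfolding X_def stab_sum_def sum_distrib_left
      by (subst sum.swap, rule sum.cong[OF refl], subst sum.swap) (simp only: comp_assoc)
    also have "\<dots> = (\<Sum>\<tau>\<in>stab cells fst. \<Sum>\<rho>\<in>stab cells snd. sign \<tau> *
        (eps (inv (\<tau> \<circ> \<rho>)) * stab_sum cells snd F g))"
      by (intro sum.cong refl arg_cong2[of _ _ _ _ "(*)"] sum_rows_translate alt g perm) (auto dest: stabD(1))
    finally show ?thesis by (simp add: hook_def sum_distrib_right mult.assoc)
  qed
  define Y where "Y g = X g - hook * F g" for g
  have "specht_like Y"
    unfolding specht_like_def
  proof (intro conjI allI impI)
    show "alternating cells fst Y"
      using alternatingD[OF alt] by (auto simp: alternating_def Y_def X_alt right_diff_distrib)
    show "all_transpositions cells Y g = eigenvalue * Y g" if "g permutes cells" for g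
      using X_eig[OF that] F that
      by (simp add: Y_def all_transpositions_def specht_like_def sum_subtractf sum_distrib_left[symmetric] right_diff_distrib)
  qed
  moreover have "stab_sum cells snd Y g = 0" if "g permutes cells" for g
    using X_rows[OF that] by (simp add: Y_def stab_sum_def sum_subtractf sum_distrib_left[symmetric])
  ultimately have "Y g = 0" using g by (rule specht_like_eq_0)
  then show ?thesis by (simp add: Y_def X_def)
qed

section \<open>Pairing with row sums, and why the scalar is not zero\<close>

definition row_norm :: "((nat \<times> nat \<Rightarrow> nat \<times> nat) \<Rightarrow> int) \<Rightarrow> int" where
  "row_norm F = (\<Sum>g | g permutes cells. (stab_sum cells snd F g)\<^sup>2)"

lemma row_norm_pos:
  assumes F: "specht_like F" and g: "g permutes cells" "F g \<noteq> 0"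
  shows "row_norm F > 0"
proof -
  obtain h where "h permutes cells" "stab_sum cells snd F h \<noteq> 0"
    using specht_like_eq_0[OF F _ g(1)] g(2) by blast
  then show ?thesis
    unfolding row_norm_def by (intro sum_pos2[of _ h]) (auto simp: finite_permutations finite_cells)
qed

text \<open>The row sum is invariant under the row group, so the other factor may be averaged over
  that group; moving the average past \<open>k\<close> leaves \<open>eps\<close>. The pairing thus
  reads off polytabloid coefficients from translates of \<open>F\<close>.\<close>

lemma row_pairing:
  assumes F: "specht_like F" and k: "k permutes cells"
  shows "int (card (stab cells snd)) * (\<Sum>g | g permutes cells. F (g \<circ> k) * stab_sum cells snd F g) =
    eps (inv k) * row_norm F"
proof -
  have "int (card (stab cells snd)) * (\<Sum>g | g permutes cells. F (g \<circ> k) * stab_sum cells snd F g) =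
    (\<Sum>\<rho>\<in>stab cells snd. \<Sum>g | g permutes cells. F (g \<circ> k) * stab_sum cells snd F g)" by simp
  also have "\<dots> = (\<Sum>\<rho>\<in>stab cells snd. \<Sum>g | g permutes cells. F (g \<circ> \<rho> \<circ> k) * stab_sum cells snd F g)"
  proof (rule sum.cong[OF refl])
    fix \<rho> assume \<rho>: "\<rho> \<in> stab cells snd"
    have "(\<Sum>g | g permutes cells. F (g \<circ> k) * stab_sum cells snd F g) =
      (\<Sum>g | g permutes cells. F (g \<circ> \<rho> \<circ> k) * stab_sum cells snd F (g \<circ> \<rho>))"
      using sum_permutes_right[OF stabD(1)[OF \<rho>], of "\<lambda>g. F (g \<circ> k) * stab_sum cells snd F g"] by simp
    then show "(\<Sum>g | g permutes cells. F (g \<circ> k) * stab_sum cells snd F g) =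
      (\<Sum>g | g permutes cells. F (g \<circ> \<rho> \<circ> k) * stab_sum cells snd F g)"
      by (simp add: stab_sum_invariant[OF \<rho>])
  qed
  also have "\<dots> = (\<Sum>g | g permutes cells. (\<Sum>\<rho>\<in>stab cells snd. F (g \<circ> \<rho> \<circ> k)) * stab_sum cells snd F g)"
    by (subst sum.swap) (simp only: sum_distrib_right)
  also have "\<dots> = (\<Sum>g | g permutes cells. eps (inv k) * (stab_sum cells snd F g)\<^sup>2)"
    using sum_rows_translate[OF specht_like_alternating[OF F] _ k]
    by (intro sum.cong) (auto simp: power2_eq_square)
  finally show ?thesis by (simp add: row_norm_def sum_distrib_left)
qed

text \<open>Otherwise pair \<open>F\<close> with \<open>x r b = 0\<close>. The alternating property
  moves \<open>b\<close> over to \<open>F\<close>, where it becomes the order of the column group.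
  So \<open>F\<close> is orthogonal to its own row sum, which makes \<open>row_norm F\<close>
  zero.\<close>

lemma hook_nonzero:
  assumes F: "specht_like F" and g: "g permutes cells" "F g \<noteq> 0"
  shows "hook \<noteq> 0"
proof
  assume "hook = 0"
  let ?r = "stab_sum cells snd F"
  have "0 = (\<Sum>g | g permutes cells. F g * (\<Sum>\<tau>\<in>stab cells fst. sign \<tau> * ?r (g \<circ> \<tau>)))"
    using column_row_sum[OF F] \<open>hook = 0\<close> by simp
  also have "\<dots> = (\<Sum>\<tau>\<in>stab cells fst. \<Sum>g | g permutes cells. (sign \<tau> * F g) * ?r (g \<circ> \<tau>))"
    unfolding sum_distrib_left by (subst sum.swap) (simp only: mult.left_commute mult.assoc)
  also have "\<dots> = (\<Sum>\<tau>\<in>stab cells fst. \<Sum>g | g permutes cells. F g * ?r g)"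
  proof (rule sum.cong[OF refl])
    fix \<tau> assume \<tau>: "\<tau> \<in> stab cells fst"
    have "(\<Sum>g | g permutes cells. (sign \<tau> * F g) * ?r (g \<circ> \<tau>)) = (\<Sum>g | g permutes cells. F (g \<circ> \<tau>) * ?r (g \<circ> \<tau>))"
      using alternatingD[OF specht_like_alternating[OF F] _ \<tau>] by (intro sum.cong) auto
    also have "\<dots> = (\<Sum>g | g permutes cells. F g * ?r g)"
      by (rule sum_permutes_right[OF stabD(1)[OF \<tau>]])
    finally show "(\<Sum>g | g permutes cells. (sign \<tau> * F g) * ?r (g \<circ> \<tau>)) = (\<Sum>g | g permutes cells. F g * ?r g)" .
  qed
  finally have "(\<Sum>g | g permutes cells. F g * ?r g) = 0"
    using card_stab_pos[OF finite_cells, of fst] by simp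
  then have "row_norm F = 0"
    using row_pairing[OF F permutes_id] by (simp add: eps_id)
  then show False using row_norm_pos[OF F g] by simp
qed

end

section \<open>The orbit sum of a closed family\<close>

lemma isp_act_comp: "isp_act (isp_act w \<sigma>) \<tau> = isp_act w (\<tau> \<circ> \<sigma>)"
  by (auto simp: isp_act_def image_image image_comp)

lemma isp_act_id [simp]: "isp_act w id = w"
  by (auto simp: isp_act_def)

lemma isp_act_eq_iff:
  assumes "\<sigma> permutes A"
  shows "isp_act w \<sigma> = U \<longleftrightarrow> w = isp_act U (inv \<sigma>)"
proof
  assume "isp_act w \<sigma> = U"
  then have "isp_act U (inv \<sigma>) = isp_act w (inv \<sigma> \<circ> \<sigma>)" by (auto simp: isp_act_comp)
  then show "w = isp_act U (inv \<sigma>)" by (simp add: comp_inv_cancel[OF assms])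
next
  assume "w = isp_act U (inv \<sigma>)"
  then show "isp_act w \<sigma> = U" by (simp add: isp_act_comp comp_inv_cancel[OF assms])
qed

text \<open>The case \<open>D = D'\<close> is included and covers a transposition inside one
  block.\<close>

lemma isp_act_fixes:
  assumes "pairwise disjnt w" "D \<in> w" "D' \<in> w" "\<tau> ` D = D'" "\<tau> ` D' = D"
    and "{x. \<tau> x \<noteq> x} \<subseteq> D \<union> D'"
  shows "isp_act w \<tau> = w"
proof -
  have *: "\<tau> ` B = B" if "B \<in> w" "B \<noteq> D" "B \<noteq> D'" for B
  proof -
    have "disjnt B D" "disjnt B D'" using assms(1-3) that by (auto simp: pairwise_def)
    then have "\<And>x. x \<in> B \<Longrightarrow> \<tau> x = x" using assms(6) by (auto simp: disjnt_iff)
    then show ?thesis by force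
  qed
  have "\<tau> ` B \<in> w" if "B \<in> w" for B using *[OF that] that assms(2-5) by metis
  moreover have "\<exists>C\<in>w. B = \<tau> ` C" if "B \<in> w" for B using *[OF that] that assms(2-5) by metis
  ultimately show ?thesis unfolding isp_act_def by blast
qed

lemma pairwise_disjnt_isp_act:
  assumes "inj \<sigma>" "pairwise disjnt w"
  shows "pairwise disjnt (isp_act w \<sigma>)"
  unfolding isp_act_def pairwise_image
  using assms(2) by (auto simp: pairwise_def disjnt_def simp flip: image_Int[OF assms(1)])

text \<open>The swap is a product of disjoint transpositions, each exchanging an element of
  \<open>D\<close> with the element of \<open>D'\<close> of the same label. The parity of the block
  size enters through its sign.\<close>

lemma ex_block_swap:
  assumes "finite D" "D \<subseteq> A" "D' \<subseteq> A" "D \<inter> D' = {}" "inj_on f D" "inj_on f D'" "f ` D = f ` D'" "finite A"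
  shows "\<exists>\<tau>\<in>stab A f. \<tau> ` D = D' \<and> \<tau> ` D' = D \<and> {x. \<tau> x \<noteq> x} \<subseteq> D \<union> D' \<and>
    (sign \<tau> :: int) = (-1) ^ card D"
  using assms
proof (induction D arbitrary: D' rule: finite_induct)
  case empty
  then show ?case by (intro bexI[of _ id]) (auto simp: id_stab sign_id)
next
  case (insert d D)
  then obtain d' where d': "d' \<in> D'" "f d' = f d" by (metis image_iff insertI1)
  define E where "E = D' - {d'}"
  have D': "D' = Set.insert d' E" "d' \<notin> E" using d' by (auto simp: E_def)
  have "f ` D = f ` E"
  proof -
    have "f ` D = f ` Set.insert d D - {f d}" using insert.hyps insert.prems(4) by (auto simp: inj_on_def)
    also have "\<dots> = f ` E" unfolding insert.prems(6) using d' insert.prems(5) by (auto simp: E_def inj_on_def)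
    finally show ?thesis .
  qed
  then obtain \<tau> where \<tau>: "\<tau> \<in> stab A f" "\<tau> ` D = E" "\<tau> ` E = D" "{x. \<tau> x \<noteq> x} \<subseteq> D \<union> E"
    "(sign \<tau> :: int) = (-1) ^ card D"
    using insert.IH[of E] insert.prems D' by (auto simp: inj_on_def)
  have dE: "d \<notin> E" "d \<noteq> d'" "d' \<notin> D" "d \<notin> D" using insert.prems insert.hyps d' by (auto simp: E_def)
  define \<sigma> where "\<sigma> = transpose d d' \<circ> \<tau>"
  have swap: "transpose d d' \<in> stab A f" using insert.prems d' by (intro transpose_stab) auto
  have "\<sigma> \<in> stab A f" unfolding \<sigma>_def using swap \<tau>(1) by (rule stab_comp)
  moreover have \<sigma>D: "\<sigma> ` D = E"
    using \<tau>(2) dE D'(2) by (auto simp: \<sigma>_def transpose_def image_iff)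
  moreover have \<sigma>E: "\<sigma> ` E = D"
    using \<tau>(3) dE D'(2) by (auto simp: \<sigma>_def transpose_def image_iff)
  moreover have off: "\<tau> x = x" if "x \<notin> D" "x \<notin> E" for x using that \<tau>(4) by blast
  have \<sigma>d: "\<sigma> d = d'" "\<sigma> d' = d" using off[of d] off[of d'] dE D'(2) by (simp_all add: \<sigma>_def)
  moreover have "{x. \<sigma> x \<noteq> x} \<subseteq> Set.insert d D \<union> D'"
  proof
    fix x assume "x \<in> {x. \<sigma> x \<noteq> x}"
    then show "x \<in> Set.insert d D \<union> D'" using off[of x] D' by (cases "x \<in> D \<or> x \<in> E") (auto simp: \<sigma>_def transpose_def split: if_splits)
  qed
  moreover have "(sign \<sigma> :: int) = (-1) ^ card (Set.insert d D)"
  proof -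
    have "sign \<sigma> = sign (transpose d d') * sign \<tau>"
      unfolding \<sigma>_def using swap \<tau>(1) \<open>finite A\<close>
      by (intro sign_compose permutes_imp_permutation[OF \<open>finite A\<close>] stabD(1))
    then show ?thesis using insert.hyps \<tau>(5) dE by (simp add: sign_swap_id)
  qed
  ultimately show ?case using D' \<sigma>d by (intro bexI[of _ \<sigma>]) auto
qed

lemma list_all2_insort:
  fixes i j :: nat
  assumes "sorted zs" "i \<le> j"
  shows "list_all2 (\<le>) (insort i zs) (insort j zs)"
  using assms
proof (induction zs arbitrary: i j)
  case (Cons z zs)
  have zs: "insort z zs = z # zs" using Cons.prems(1) by (cases zs) auto
  \<comment> \<open>For the case \<open>i \<le> z < j\<close>: the heads are \<open>i\<close> and
    \<open>z\<close>, and in the tails \<open>z\<close> takes the place of \<open>i\<close>.\<close>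
  have "list_all2 (\<le>) (insort z zs) (insort j zs)" if "z \<le> j"
    using Cons.IH[of z j] that Cons.prems by simp
  moreover have "list_all2 (\<le>) zs zs" by (simp add: list_all2_refl)
  ultimately show ?case using Cons zs by auto
qed simp

lemma majorized_replace:
  assumes "finite Y" "j \<in> Y" "i \<notin> Y" "i \<le> j"
  shows "majorized (insert i (Y - {j})) Y"
proof -
  define Z where "Z = Y - {j}"
  have "Y = insert j Z" "finite Z" "j \<notin> Z" "i \<notin> Z" using assms by (auto simp: Z_def)
  then show ?thesis
    unfolding majorized_def Z_def[symmetric]
    by (simp add: list_all2_insort assms(4))
qed

lemma m_subset_replace:
  assumes "m_subset m Y" "j \<in> Y" "i \<notin> Y" "1 \<le> i"
  shows "m_subset m (insert i (Y - {j}))"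
proof -
  have "Suc (card (Y - {j})) = card Y" using assms by (intro card.remove[symmetric]) (auto simp: m_subset_def)
  then show ?thesis using assms by (auto simp: m_subset_def)
qed

text \<open>Forgetting indices makes the blocks of \<open>u\<close> correspond bijectively to the
  sets of \<open>P\<close>. The rule for appending indices is thereby separated from the argument on
  exchanges.\<close>

locale foulkes_family = young_diagram +
  fixes m :: nat and P :: "nat set set" and u :: "sym set set"
  assumes odd_m: "odd m" and closed: "closed_family m P" and sets: "\<And>X. X \<in> P \<Longrightarrow> m_subset m X"
    and Union_u: "\<Union>u = cells" and disj: "pairwise disjnt u"
    and inj_block: "\<And>B. B \<in> u \<Longrightarrow> inj_on fst B" and inj_u: "inj_on ((`) fst) u" and image_u: "((`) fst) ` u = P"
begin

text \<open>The vector \<open>w b\<close>, for any \<open>w\<close>, so that it can be applied to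
  \<open>u\<close> after an exchange of symbols.\<close>

definition signed_orbit :: "sym set set \<Rightarrow> sym set set \<Rightarrow> int" where
  "signed_orbit w = (\<lambda>U. \<Sum>\<tau>\<in>stab cells fst. if isp_act w \<tau> = U then sign \<tau> else 0)"

lemma sign_comp_stab: "\<sigma> \<in> stab cells \<mu> \<Longrightarrow> \<tau> \<in> stab cells \<nu> \<Longrightarrow> sign (\<sigma> \<circ> \<tau>) = sign \<sigma> * sign \<tau>"
  by (intro sign_compose permutes_imp_permutation[OF finite_cells] stabD(1))

lemma signed_orbit_act:
  assumes \<sigma>: "\<sigma> \<in> stab cells fst"
  shows "signed_orbit (isp_act w \<sigma>) U = sign \<sigma> * signed_orbit w U"
proof -
  have "sign \<sigma> * signed_orbit (isp_act w \<sigma>) U = (\<Sum>\<tau>\<in>stab cells fst. if isp_act w (\<tau> \<circ> \<sigma>) = U then sign (\<tau> \<circ> \<sigma>) else 0)"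
    unfolding signed_orbit_def sum_distrib_left
    by (intro sum.cong refl) (simp add: isp_act_comp sign_comp_stab[OF _ \<sigma>])
  also have "\<dots> = signed_orbit w U"
    unfolding signed_orbit_def by (rule sum_stab_right[OF \<sigma>])
  finally show ?thesis by (metis sign_mult_self)
qed

text \<open>Here \<open>w b = (w \<sigma>) b = - w b\<close>, and the coefficients are
  integers.\<close>

lemma signed_orbit_eq_0:
  assumes "\<sigma> \<in> stab cells fst" "isp_act w \<sigma> = w" "sign \<sigma> = (-1 :: int)"
  shows "signed_orbit w U = 0"
  using signed_orbit_act[OF assms(1), of w U] assms(2,3) by simp

lemma signed_orbit_repeated:
  assumes w: "pairwise disjnt w" "D \<in> w" "D \<subseteq> cells" and pq: "p \<in> D" "q \<in> D" "p \<noteq> q" "fst p = fst q"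
  shows "signed_orbit w U = 0"
proof (rule signed_orbit_eq_0)
  show "transpose p q \<in> stab cells fst" using assms by (intro transpose_stab) auto
  show "isp_act w (transpose p q) = w"
    using pq by (intro isp_act_fixes[OF w(1,2,2)]) (auto simp: transpose_def)
  show "sign (transpose p q) = (-1 :: int)" using pq by (simp add: sign_swap_id)
qed

lemma block_exists: "x \<in> cells \<Longrightarrow> \<exists>B\<in>u. x \<in> B"
  using Union_u by blast

lemma block_unique: "B \<in> u \<Longrightarrow> B' \<in> u \<Longrightarrow> x \<in> B \<Longrightarrow> x \<in> B' \<Longrightarrow> B = B'"
  using disj unfolding pairwise_def disjnt_def by blast

lemma block_cells: "B \<in> u \<Longrightarrow> B \<subseteq> cells"
  using Union_u by blast

lemma card_block: "B \<in> u \<Longrightarrow> card B = m"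
  using card_image[OF inj_block] sets image_u by (force simp: m_subset_def)

lemma transpose_image:
  assumes "x \<in> B" "y \<notin> B"
  shows "transpose x y ` B = insert y (B - {x})"
  using assms by (auto simp: transpose_def image_iff)

text \<open>An exchange inside one block fixes \<open>u\<close>. Otherwise a block may acquire a
  repeated number; if not, closure provides a block \<open>Z\<close> of \<open>u\<close> with the
  numbers of the changed \<open>B'\<close>. If \<open>Z = B\<close>, the two blocks have traded
  their sets of numbers, and an even column permutation restores \<open>u\<close>. If
  \<open>Z\<close> is another block, swapping it with the changed \<open>B'\<close> is odd, as
  \<open>m\<close> is odd, and fixes the set partition, so the result is 0.\<close>

lemma exchange_term:
  assumes x: "x \<in> B" "B \<in> u" and y: "y \<in> B'" "B' \<in> u" and less: "fst x < fst y"
  shows "signed_orbit (isp_act u (transpose x y)) U =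
    (if B = B' \<or> (fst x \<notin> fst ` B' \<and> fst ` B = insert (fst x) (fst ` B' - {fst y})) then signed_orbit u U else 0)"
proof (cases "B = B'")
  case True
  then have "isp_act u (transpose x y) = u"
    using x y by (intro isp_act_fixes[OF disj x(2,2)]) (auto simp: transpose_def)
  then show ?thesis using True by simp
next
  case False
  let ?s = "transpose x y"
  define w where "w = isp_act u ?s"
  have ne: "x \<noteq> y" "x \<notin> B'" "y \<notin> B" using False block_unique[OF x(2) y(2)] x y less by blast+
  have w_disj: "pairwise disjnt w" unfolding w_def by (rule pairwise_disjnt_isp_act[OF bij_is_inj[OF bij_transpose] disj])
  have xy: "x \<in> cells" "y \<in> cells" using x y block_cells by auto
  have sB: "?s ` B = insert y (B - {x})" by (rule transpose_image[OF x(1) ne(3)])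
  have sB': "?s ` B' = insert x (B' - {y})" using transpose_image[OF y(1) ne(2)] by (simp add: transpose_commute)
  have w_mem: "insert y (B - {x}) \<in> w" "insert x (B' - {y}) \<in> w"
    using x y unfolding w_def isp_act_def sB[symmetric] sB'[symmetric] by auto
  have sub: "insert y (B - {x}) \<subseteq> cells" "insert x (B' - {y}) \<subseteq> cells" using block_cells x y xy by auto
  consider (a) "fst x \<in> fst ` B'" | (b) "fst y \<in> fst ` B" | (c) "fst x \<notin> fst ` B'" "fst y \<notin> fst ` B" by blast
  then show ?thesis
  proof cases
    case a
    then obtain p where "p \<in> B'" "fst p = fst x" by force
    then have "signed_orbit w U = 0"
      using ne less by (intro signed_orbit_repeated[OF w_disj w_mem(2) sub(2), of p x]) auto
    then show ?thesis using False a by (auto simp: w_def)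
  next
    case b
    then obtain p where "p \<in> B" "fst p = fst y" by force
    then have "signed_orbit w U = 0"
      using ne less by (intro signed_orbit_repeated[OF w_disj w_mem(1) sub(1), of p y]) auto
    moreover have "fst y \<notin> insert (fst x) (fst ` B' - {fst y})" using less by simp
    then have "fst ` B \<noteq> insert (fst x) (fst ` B' - {fst y})" using b by metis
    ultimately show ?thesis using False by (auto simp: w_def)
  next
    case c
    let ?Y = "insert (fst x) (fst ` B' - {fst y})"
    have "fst ` B' \<in> P" using image_u y by blast
    then have B'_sub: "m_subset m (fst ` B')" by (rule sets)
    have "m_subset m ?Y"
      using B'_sub c y xy by (intro m_subset_replace) (auto simp: cells_def)
    moreover have "majorized ?Y (fst ` B')"
      using B'_sub c y less by (intro majorized_replace) (auto simp: m_subset_def)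
    ultimately have "?Y \<in> P" using closed \<open>fst ` B' \<in> P\<close> by (auto simp: closed_family_def)
    then obtain Z where Z: "Z \<in> u" "fst ` Z = ?Y" using image_u by force
    have inj_B: "inj_on fst B" "inj_on fst B'" "inj_on fst Z" using inj_block x y Z by auto
    have fst_del: "fst ` (B' - {y}) = fst ` B' - {fst y}" "fst ` (B - {x}) = fst ` B - {fst x}"
      using inj_B x y by (auto simp: inj_on_def)
    have blocks: "B \<subseteq> cells" "B' \<subseteq> cells" "Z \<subseteq> cells" using block_cells x y Z by auto
    have fin: "finite B" "finite B'" using finite_subset[OF block_cells finite_cells] x y by auto
    show ?thesis
    proof (cases "fst ` B = ?Y")
      case True
      have "\<exists>\<tau>\<in>stab cells fst. \<tau> ` (B - {x}) = B' - {y} \<and> \<tau> ` (B' - {y}) = B - {x} \<and>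
          {z. \<tau> z \<noteq> z} \<subseteq> B - {x} \<union> (B' - {y}) \<and> (sign \<tau> :: int) = (-1) ^ card (B - {x})"
      proof (rule ex_block_swap)
        show "fst ` (B - {x}) = fst ` (B' - {y})" using True c unfolding fst_del by auto
        show "(B - {x}) \<inter> (B' - {y}) = {}" using False block_unique x y by blast
      qed (use inj_B fin blocks finite_cells in \<open>auto intro: inj_on_diff\<close>)
      then obtain \<tau> where \<tau>: "\<tau> \<in> stab cells fst" "\<tau> ` (B - {x}) = B' - {y}" "\<tau> ` (B' - {y}) = B - {x}"
        "{z. \<tau> z \<noteq> z} \<subseteq> B - {x} \<union> (B' - {y})" "(sign \<tau> :: int) = (-1) ^ card (B - {x})"
        by (elim bexE conjE) (rule that; assumption)
      \<comment> \<open>\<open>x\<close> and \<open>y\<close> already lie in the right blocks, so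
        \<open>m - 1\<close> pairs are swapped, an even number.\<close>
      have "card (B - {x}) = m - 1" using x fin card_block by simp
      then have "sign \<tau> = (1 :: int)" using \<tau>(5) odd_m by simp
      moreover have off: "\<tau> z = z" if "z \<notin> B - {x}" "z \<notin> B' - {y}" for z using that \<tau>(4) by blast
      have \<tau>xy: "\<tau> x = x" "\<tau> y = y" using off[of x] off[of y] ne by auto
      have "isp_act u (\<tau> \<circ> ?s) = u"
      proof (rule isp_act_fixes[OF disj x(2) y(2)])
        show "(\<tau> \<circ> ?s) ` B = B'"
          unfolding image_comp[symmetric] sB image_insert \<tau>(2) \<tau>xy using y by auto
        show "(\<tau> \<circ> ?s) ` B' = B"
          unfolding image_comp[symmetric] sB' image_insert \<tau>(3) \<tau>xy using x by auto
        show "{z. (\<tau> \<circ> ?s) z \<noteq> z} \<subseteq> B \<union> B'"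
        proof
          fix z assume "z \<in> {z. (\<tau> \<circ> ?s) z \<noteq> z}"
          then show "z \<in> B \<union> B'" using off[of z] x y by (cases "z \<in> B \<union> B'") (auto simp: transpose_def split: if_splits)
        qed
      qed
      ultimately have "signed_orbit w U = signed_orbit u U"
        using signed_orbit_act[OF \<tau>(1), of w U] by (simp add: w_def isp_act_comp)
      then show ?thesis using True c by (simp add: w_def)
    next
      case neq: False
      have Z_ne: "Z \<noteq> B" "Z \<noteq> B'" using neq Z c by auto
      have xyZ: "x \<notin> Z" "y \<notin> Z" using Z_ne block_unique x y Z(1) by blast+
      have "?s ` Z = id ` Z" by (rule image_cong) (use xyZ in \<open>auto simp: transpose_def\<close>)
      then have Zw: "Z \<in> w" using imageI[OF Z(1), of "(`) ?s"] by (simp add: w_def isp_act_def)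
      have "\<exists>\<tau>\<in>stab cells fst. \<tau> ` insert x (B' - {y}) = Z \<and> \<tau> ` Z = insert x (B' - {y}) \<and>
          {z. \<tau> z \<noteq> z} \<subseteq> insert x (B' - {y}) \<union> Z \<and> (sign \<tau> :: int) = (-1) ^ card (insert x (B' - {y}))"
      proof (rule ex_block_swap)
        show "fst ` insert x (B' - {y}) = fst ` Z" using Z by (simp add: fst_del)
        show "insert x (B' - {y}) \<inter> Z = {}" using xyZ Z_ne block_unique Z(1) y by blast
        show "inj_on fst (insert x (B' - {y}))"
          using inj_on_diff[OF inj_B(2), of "{y}"] c(1) by (subst inj_on_insert) blast
      qed (use inj_B fin blocks sub finite_cells in auto)
      then obtain \<tau> where \<tau>: "\<tau> \<in> stab cells fst" "\<tau> ` insert x (B' - {y}) = Z" "\<tau> ` Z = insert x (B' - {y})"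
        "{z. \<tau> z \<noteq> z} \<subseteq> insert x (B' - {y}) \<union> Z"
        "(sign \<tau> :: int) = (-1) ^ card (insert x (B' - {y}))"
        by (elim bexE conjE) (rule that; assumption)
      have "card (insert x (B' - {y})) = m"
        using ne y fin card_block[OF y(2)] card_gt_0_iff[of B'] by (auto simp: card_insert_if)
      then have sgn: "sign \<tau> = (-1 :: int)" using \<tau>(5) odd_m by simp
      have "isp_act w \<tau> = w" by (rule isp_act_fixes[OF w_disj w_mem(2) Zw \<tau>(2-4)])
      then have "signed_orbit w U = 0" by (rule signed_orbit_eq_0[OF \<tau>(1) _ sgn])
      then show ?thesis using neq False by (simp add: w_def)
    qed
  qed
qed

text \<open>Multilinear form of the statement that the raising operator replacing \<open>fst y\<close> by \<open>i\<close> kills the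
  wedge product of the sets of a closed family.\<close>

lemma exchange_sum:
  assumes y: "y \<in> cells" and i: "i < fst y" "1 \<le> i"
  shows "(\<Sum>x\<in>{x \<in> cells. fst x = i}. signed_orbit (isp_act u (transpose x y)) U) = signed_orbit u U"
proof -
  obtain B' where B': "B' \<in> u" "y \<in> B'" using block_exists[OF y] by blast
  define good where "good C \<longleftrightarrow> C = B' \<or> (i \<notin> fst ` B' \<and> fst ` C = insert i (fst ` B' - {fst y}))" for C
  \<comment> \<open>\<open>good\<close> marks the blocks for which the exchange returns
    \<open>u b\<close>. Among the blocks containing the number \<open>i\<close> exactly one is good:
    \<open>B'\<close> itself, or the block given by closure if \<open>i\<close> does not occur in
    \<open>B'\<close>. Numbers do not repeat in a block, so exactly one \<open>x\<close>
    survives.\<close>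
  have "\<exists>B\<in>u. i \<in> fst ` B \<and> (\<forall>C\<in>u. i \<in> fst ` C \<longrightarrow> good C \<longleftrightarrow> C = B)"
  proof (cases "i \<in> fst ` B'")
    case True
    then show ?thesis using B' by (intro bexI[of _ B']) (auto simp: good_def)
  next
    case False
    have "fst ` B' \<in> P" using image_u B' by blast
    then have B'_sub: "m_subset m (fst ` B')" by (rule sets)
    have "m_subset m (insert i (fst ` B' - {fst y}))"
      using B'_sub False B' i by (intro m_subset_replace) auto
    moreover have "majorized (insert i (fst ` B' - {fst y})) (fst ` B')"
      using B'_sub False B' i by (intro majorized_replace) (auto simp: m_subset_def)
    ultimately have "insert i (fst ` B' - {fst y}) \<in> P"
      using closed \<open>fst ` B' \<in> P\<close> by (auto simp: closed_family_def)
    then obtain Z where Z: "Z \<in> u" "fst ` Z = insert i (fst ` B' - {fst y})" using image_u by force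
    have "good C \<longleftrightarrow> C = Z"
      if C: "C \<in> u" "i \<in> fst ` C" for C
      using inj_on_eq_iff[OF inj_u C(1) Z(1)] Z(2) False C(2) unfolding good_def by metis
    then show ?thesis using Z by (intro bexI[of _ Z]) auto
  qed
  then obtain B where B: "B \<in> u" "i \<in> fst ` B" and good_iff: "\<And>C. C \<in> u \<Longrightarrow> i \<in> fst ` C \<Longrightarrow>
      good C \<longleftrightarrow> C = B"
    by blast
  from B(2) obtain x0 where x0: "x0 \<in> B" "fst x0 = i" by force
  have "signed_orbit (isp_act u (transpose x y)) U = (if x = x0 then signed_orbit u U else 0)"
    if x: "x \<in> cells" "fst x = i" for x
  proof -
    obtain C where C: "C \<in> u" "x \<in> C" using block_exists x by blast
    then have "i \<in> fst ` C" using x by auto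
    note * = good_iff[OF C(1) this]
    have "C = B \<longleftrightarrow> x = x0"
    proof
      show "x = x0" if "C = B" using inj_onD[OF inj_block[OF B(1)], of x x0] that C x x0 by simp
      show "C = B" if "x = x0" using block_unique[OF C(1) B(1), of x0] that C x0 by simp
    qed
    then show ?thesis
      using exchange_term[OF C(2,1) B'(2,1), of U] i x * by (simp add: good_def)
  qed
  then have "(\<Sum>x\<in>{x \<in> cells. fst x = i}. signed_orbit (isp_act u (transpose x y)) U) =
      (\<Sum>x\<in>{x \<in> cells. fst x = i}. if x = x0 then signed_orbit u U else 0)"
    by (intro sum.cong) auto
  also have "\<dots> = signed_orbit u U"
    using finite_cells x0 B(1) block_cells by (subst sum.delta) auto
  finally show ?thesis .
qed

text \<open>In a column of length \<open>c\<close> the diagonal pairs keep \<open>u b\<close> and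
  the others change its sign, giving \<open>c - c (c - 1) = 2 c - c^2\<close>. For two columns, each
  symbol of the later, shorter one gives \<open>u b\<close> once by the exchange relation, in total
  the minimum of the lengths.\<close>

lemma signed_orbit_eigenvector:
  "(\<Sum>x\<in>cells. \<Sum>y\<in>cells. signed_orbit (isp_act u (transpose x y)) U) = eigenvalue * signed_orbit u U"
proof -
  let ?b = "\<lambda>x y. signed_orbit (isp_act u (transpose x y)) U" and ?D = "\<lambda>i. {x \<in> cells. fst x = i}"
  have cols: "1 \<le> i" "i \<le> a" if "i \<in> fst ` cells" for i using that by (auto simp: columns)
  have diag: "(\<Sum>x\<in>?D i. \<Sum>y\<in>?D i. ?b x y) = (2 * int (card (?D i)) - int (card (?D i)) * int (card (?D i))) * signed_orbit u U"
    for i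
  proof -
    have "?b x y = (2 * of_bool (x = y) - 1) * signed_orbit u U" if "x \<in> ?D i" "y \<in> ?D i" for x y
      using signed_orbit_act[OF transpose_stab[of x cells y fst], of u U] that by (auto simp: sign_swap_id)
    then have "(\<Sum>x\<in>?D i. \<Sum>y\<in>?D i. ?b x y) = (\<Sum>x\<in>?D i. \<Sum>y\<in>?D i. (2 * of_bool (x = y) - 1) * signed_orbit u U)"
      by (intro sum.cong refl) auto
    also have "\<dots> = (\<Sum>x\<in>?D i. (\<Sum>y\<in>?D i. 2 * (if x = y then 1 else 0)) - int (card (?D i))) * signed_orbit u U"
      by (simp add: sum_distrib_right[symmetric] sum_subtractf of_bool_def)
    also have "(\<Sum>x\<in>?D i. (\<Sum>y\<in>?D i. 2 * (if x = y then 1 else 0)) - int (card (?D i))) = (\<Sum>x\<in>?D i. 2 - int (card (?D i)))"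
      using finite_cells by (intro sum.cong refl) (simp add: sum_distrib_left[symmetric])
    finally show ?thesis by (simp add: algebra_simps)
  qed
  have half: "(\<Sum>x\<in>?D i. \<Sum>y\<in>?D j. ?b x y) = int (card (?D j)) * signed_orbit u U" if "1 \<le> i" "i < j" for i j
  proof -
    have "(\<Sum>x\<in>?D i. \<Sum>y\<in>?D j. ?b x y) = (\<Sum>y\<in>?D j. \<Sum>x\<in>?D i. ?b x y)" by (rule sum.swap)
    also have "\<dots> = (\<Sum>y\<in>?D j. signed_orbit u U)"
      using that by (intro sum.cong refl exchange_sum) auto
    finally show ?thesis by simp
  qed
  have off: "(\<Sum>x\<in>?D i. \<Sum>y\<in>?D j. ?b x y) = int (min (card (?D i)) (card (?D j))) * signed_orbit u U"
    if "i \<in> fst ` cells" "j \<in> fst ` cells - {i}" for i j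
  proof -
    have ij: "1 \<le> i" "i \<le> a" "1 \<le> j" "j \<le> a" "i \<noteq> j" using that cols by auto
    show ?thesis
    proof (cases "i < j")
      case True
      then show ?thesis using half[OF ij(1) True] ij antitone[of i j] by (simp add: card_column min_def)
    next
      case False
      have "(\<Sum>x\<in>?D i. \<Sum>y\<in>?D j. ?b x y) = (\<Sum>y\<in>?D j. \<Sum>x\<in>?D i. ?b y x)"
        by (subst sum.swap) (simp add: transpose_commute)
      also have "\<dots> = int (card (?D i)) * signed_orbit u U" using half[of j i] ij False by simp
      finally show ?thesis using ij False antitone[of j i] by (simp add: card_column min_def)
    qed
  qed
  have N: "int (card cells) = (\<Sum>i\<in>fst ` cells. int (card (?D i)))"
    using sum.image_gen[OF finite_cells, of "\<lambda>_. 1::int" fst] by simp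
  have Q: "same_label cells fst = (\<Sum>i\<in>fst ` cells. int (card (?D i)) * int (card (?D i)))"
  proof -
    have "same_label cells fst = (\<Sum>i\<in>fst ` cells. \<Sum>x\<in>?D i. \<Sum>y\<in>?D i. 1) + (\<Sum>i\<in>fst ` cells. \<Sum>j\<in>fst ` cells - {i}. \<Sum>x\<in>?D i. \<Sum>y\<in>?D j. 0)"
      unfolding same_label_def sum_by_fibres[OF finite_cells, of _ fst]
      by (intro arg_cong2[of _ _ _ _ "(+)"] sum.cong refl) auto
    then show ?thesis by simp
  qed
  have "(\<Sum>x\<in>cells. \<Sum>y\<in>cells. ?b x y) =
    (\<Sum>i\<in>fst ` cells. (2 * int (card (?D i)) - int (card (?D i)) * int (card (?D i))) * signed_orbit u U) +
    (\<Sum>i\<in>fst ` cells. \<Sum>j\<in>fst ` cells - {i}. int (min (card (?D i)) (card (?D j))) * signed_orbit u U)"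
    unfolding sum_by_fibres[OF finite_cells, of _ fst]
    by (intro arg_cong2[of _ _ _ _ "(+)"] sum.cong refl diag off)
  also have "\<dots> = eigenvalue * signed_orbit u U"
    unfolding eigenvalue_def min_overlap_def N Q
    by (simp add: sum_distrib_right[symmetric] sum_subtractf sum_distrib_left[symmetric] algebra_simps)
  finally show ?thesis .
qed

section \<open>The coefficient functions of \<open>v = u b\<close>\<close>

definition coefficient :: "sym set set \<Rightarrow> (sym \<Rightarrow> sym) \<Rightarrow> int" where
  "coefficient U g = signed_orbit u (isp_act U (inv g))"

lemma inv_comp_permutes: "g permutes A \<Longrightarrow> h permutes A \<Longrightarrow> inv (g \<circ> h) = inv h \<circ> inv g"
  by (meson o_inv_distrib permutes_bij)

lemma coefficient_translate:
  "g permutes cells \<Longrightarrow> h permutes cells \<Longrightarrow> coefficient (isp_act U (inv g)) h = coefficient U (g \<circ> h)"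
  by (simp add: coefficient_def isp_act_comp inv_comp_permutes)

text \<open>Alternation comes from \<open>b \<tau> = sgn(\<tau>) b\<close>. The transposition sum is
  central, so it may act on \<open>u\<close> before \<open>b\<close> does, and there the exchange
  relations give the scalar.\<close>

lemma specht_like_coefficient: "specht_like (coefficient U)"
  unfolding specht_like_def
proof (intro conjI allI impI)
  show "alternating cells fst (coefficient U)"
    unfolding alternating_def
  proof (intro allI impI)
    fix g \<tau> assume g: "g permutes cells" and \<tau>: "\<tau> \<in> stab cells fst"
    note \<tau>p = stabD(1)[OF \<tau>]
    define V where "V = isp_act U (inv g)"
    have "coefficient U (g \<circ> \<tau>) = signed_orbit u (isp_act V (inv \<tau>))"
      by (simp add: coefficient_def V_def isp_act_comp inv_comp_permutes[OF g \<tau>p])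
    also have "\<dots> = (\<Sum>\<sigma>\<in>stab cells fst. sign \<tau> * (if isp_act u (\<tau> \<circ> \<sigma>) = V then sign (\<tau> \<circ> \<sigma>) else 0))"
      unfolding signed_orbit_def
      by (intro sum.cong refl)
         (auto simp: isp_act_eq_iff[OF \<tau>p, symmetric] isp_act_comp sign_comp_stab[OF \<tau>] sign_mult_self)
    also have "\<dots> = sign \<tau> * signed_orbit u V"
      unfolding signed_orbit_def sum_distrib_left[symmetric]
      by (rule arg_cong[OF sum_stab_left[OF \<tau>]])
    finally show "coefficient U (g \<circ> \<tau>) = sign \<tau> * coefficient U g" by (simp add: coefficient_def V_def)
  qed
next
  fix g assume g: "g permutes cells"
  define V where "V = isp_act U (inv g)"
  have swap: "transpose x y permutes cells" if "x \<in> cells" "y \<in> cells" for x y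
    using that by (rule permutes_swap_id)
  \<comment> \<open>The leading \<open>id\<close> gives the summands the shape in which the
    transpositions can be moved past \<open>\<tau>\<close>.\<close>
  have "all_transpositions cells (coefficient U) g = (\<Sum>x\<in>cells. \<Sum>y\<in>cells. \<Sum>\<tau>\<in>stab cells fst.
      if isp_act u (id \<circ> transpose x y \<circ> \<tau>) = V then sign \<tau> else 0)"
    unfolding all_transpositions_def
  proof (intro sum.cong refl)
    fix x y assume "x \<in> cells" "y \<in> cells"
    note s = swap[OF this]
    have "coefficient U (g \<circ> transpose x y) = signed_orbit u (isp_act V (inv (transpose x y)))"
      by (simp add: coefficient_def V_def isp_act_comp inv_comp_permutes[OF g s])
    then show "coefficient U (g \<circ> transpose x y) =
      (\<Sum>\<tau>\<in>stab cells fst. if isp_act u (id \<circ> transpose x y \<circ> \<tau>) = V then sign \<tau> else 0)"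
      unfolding signed_orbit_def isp_act_eq_iff[OF s, symmetric] by (simp add: isp_act_comp)
  qed
  also have "\<dots> = (\<Sum>\<tau>\<in>stab cells fst. \<Sum>x\<in>cells. \<Sum>y\<in>cells.
      if isp_act u (id \<circ> transpose x y \<circ> \<tau>) = V then sign \<tau> else 0)"
    by (rule sum_swap3)
  also have "\<dots> = (\<Sum>\<tau>\<in>stab cells fst. \<Sum>x\<in>cells. \<Sum>y\<in>cells.
      if isp_act u (\<tau> \<circ> transpose x y) = V then sign \<tau> else 0)"
  proof (rule sum.cong[OF refl])
    fix \<tau> assume "\<tau> \<in> stab cells fst"
    from all_transpositions_conj[OF stabD(1)[OF this], of "\<lambda>h. if isp_act u h = V then sign \<tau> else 0" id]
    show "(\<Sum>x\<in>cells. \<Sum>y\<in>cells. if isp_act u (id \<circ> transpose x y \<circ> \<tau>) = V then sign \<tau> else (0::int)) =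
      (\<Sum>x\<in>cells. \<Sum>y\<in>cells. if isp_act u (\<tau> \<circ> transpose x y) = V then sign \<tau> else 0)"
      by (simp add: all_transpositions_def)
  qed
  also have "\<dots> = (\<Sum>x\<in>cells. \<Sum>y\<in>cells. signed_orbit (isp_act u (transpose x y)) V)"
    unfolding signed_orbit_def isp_act_comp by (rule sum_swap3[symmetric])
  also have "\<dots> = eigenvalue * coefficient U g"
    by (simp add: signed_orbit_eigenvector coefficient_def V_def)
  finally show "all_transpositions cells (coefficient U) g = eigenvalue * coefficient U g" .
qed

text \<open>A column permutation keeps numbers. If it fixes \<open>u\<close>, it maps each block to
  the block with the same numbers, which is that block itself, and hence fixes each symbol. So only
  the identity contributes.\<close>

lemma coefficient_nonzero: "coefficient u id = 1"
proof -
  have "isp_act u \<tau> = u \<longleftrightarrow> \<tau> = id" if \<tau>: "\<tau> \<in> stab cells fst" for \<tau>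
  proof
    assume fix_u: "isp_act u \<tau> = u"
    show "\<tau> = id"
    proof
      fix x show "\<tau> x = id x"
      proof (cases "x \<in> cells")
        case True
        then obtain B where B: "B \<in> u" "x \<in> B" using block_exists by blast
        have "\<tau> ` B \<in> u" using fix_u B(1) unfolding isp_act_def by blast
        moreover have "fst ` \<tau> ` B = fst ` B"
          unfolding image_image using stabD(2)[OF \<tau>] block_cells[OF B(1)] by (intro image_cong) auto
        ultimately have "\<tau> ` B = B" using inj_onD[OF inj_u] B(1) by blast
        then have "\<tau> x \<in> B" using B(2) by blast
        then show ?thesis using inj_onD[OF inj_block[OF B(1)] stabD(2)[OF \<tau> True]] B(2) by simp
      next
        case False
        then show ?thesis using permutes_not_in[OF stabD(1)[OF \<tau>]] by simp
      qed
    qed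
  qed simp
  then have "coefficient u id = (\<Sum>\<tau>\<in>stab cells fst. if \<tau> = id then sign \<tau> else 0)"
    unfolding coefficient_def signed_orbit_def by (intro sum.cong refl) (auto simp: inv_id)
  also have "\<dots> = 1"
    by (subst sum.delta[OF finite_stab[OF finite_cells]]) (simp add: id_stab sign_id)
  finally show ?thesis .
qed

end

section \<open>Associated set partitions and polytabloids\<close>

text \<open>Justifies the definite description: the sorted lists encode the sets faithfully, and the
  lexicographic order on lists is linear.\<close>

lemma lex_list:
  assumes P: "finite P" "\<And>X. X \<in> P \<Longrightarrow> finite X"
  shows "distinct (lex_list P)" "set (lex_list P) = P"
proof -
  define sl :: "nat set \<Rightarrow> nat list" where "sl = sorted_list_of_set"
  have less: "lex_less = (\<lambda>X Y. sl X < sl Y)"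
    by (simp add: fun_eq_iff lex_less_def list_less_def sl_def)
  have set_sl: "set (sl X) = X" if "X \<in> P" for X using P(2)[OF that] by (simp add: sl_def)
  define Ls where "Ls = sorted_list_of_set (sl ` P)"
  have Ls: "set Ls = sl ` P" "sorted_wrt (<) Ls" "distinct Ls"
    using P(1) by (simp_all add: Ls_def)
  have map_sl: "map sl (map set Ls) = Ls"
    unfolding map_map by (rule map_idI) (use Ls(1) set_sl in auto)
  have "\<exists>!Xs. distinct Xs \<and> set Xs = P \<and> sorted_wrt lex_less Xs"
  proof (rule ex1I[of _ "map set Ls"], intro conjI)
    show "distinct (map set Ls)" using Ls(3) map_sl by (metis distinct_map)
    show "set (map set Ls) = P" using Ls(1) set_sl by (force simp: image_iff)
    show "sorted_wrt lex_less (map set Ls)"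
    proof -
      have "sorted_wrt (\<lambda>X Y. sl X < sl Y) (map set Ls)"
        using Ls(2) map_sl sorted_wrt_map[of "(<)" sl "map set Ls"] by simp
      then show ?thesis by (simp add: less)
    qed
    fix Xs assume Xs: "distinct Xs \<and> set Xs = P \<and> sorted_wrt lex_less Xs"
    have "sorted_wrt (<) (map sl Xs)" using Xs by (simp add: sorted_wrt_map less)
    then have "map sl Xs = Ls" using Ls Xs by (intro strict_sorted_equal) auto
    then have "map set Ls = map (set \<circ> sl) Xs" by auto
    also have "\<dots> = Xs" by (rule map_idI) (use Xs set_sl in auto)
    finally show "Xs = map set Ls" ..
  qed
  from theI'[OF this] show "distinct (lex_list P)" "set (lex_list P) = P"
    unfolding lex_list_def by auto
qed

text \<open>The invariant is that the indices already given to \<open>i\<close> form an initial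
  segment \<open>{1..k i}\<close>. The least free index is then \<open>k i + 1\<close>, and the
  further indices follow without gap, one for each remaining set containing
  \<open>i\<close>.\<close>

lemma assign_idx:
  assumes "\<And>i. used i = {1..k i}" "distinct Xs"
  shows "map ((`) fst) (assign_idx Xs used) = Xs"
    "\<And>B. B \<in> set (assign_idx Xs used) \<Longrightarrow> inj_on fst B"
    "\<Union>(set (assign_idx Xs used)) = {(i, j). k i < j \<and> j \<le> k i + card {X \<in> set Xs. i \<in> X}}"
    "pairwise disjnt (set (assign_idx Xs used))"
  using assms
proof (induction Xs arbitrary: used k)
  case Nil
  { case 1 then show ?case by simp next
    case 2 then show ?case by simp next
    case 3 then show ?case by auto next
    case 4 then show ?case by simp }
next
  case (Cons X Xs)
  have ix: "(LEAST j. 1 \<le> j \<and> j \<notin> used i) = Suc (k i)" if "used i = {1..k i}"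
    for used :: "nat \<Rightarrow> nat set" and k :: "nat \<Rightarrow> nat" and i
    unfolding that by (rule Least_equality) auto
  define k' where "k' k i = (if i \<in> X then Suc (k i) else k i)" for k :: "nat \<Rightarrow> nat" and i
  define used' where "used' used k i = (if i \<in> X then insert (Suc (k i)) (used i) else used i)"
    for used :: "nat \<Rightarrow> nat set" and k :: "nat \<Rightarrow> nat" and i
  define H where "H k = (\<lambda>i. (i, Suc (k i))) ` X" for k :: "nat \<Rightarrow> nat"
  have step: "assign_idx (X # Xs) used = H k # assign_idx Xs (used' used k)"
    and used': "used' used k i = {1..k' k i}"
    if "\<And>i. used i = {1..k i}" for used k i
  proof -
    show "assign_idx (X # Xs) used = H k # assign_idx Xs (used' used k)"
      by (simp only: assign_idx.simps Let_def ix[where used = used and k = k, OF that] H_def used'_def[abs_def])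
    show "used' used k i = {1..k' k i}" by (auto simp: used'_def k'_def that)
  qed
  have union: "\<Union>(set (assign_idx Xs (used' used k))) = {(i, j). k' k i < j \<and> j \<le> k' k i + card {X \<in> set Xs. i \<in> X}}"
    if "\<And>i. used i = {1..k i}" "distinct Xs" for used k
    by (rule Cons.IH(3)[where used = "used' used k" and k = "k' k"]) (use used'[of used k] that in auto)
  { case 1
    show ?case
      unfolding step[of used k, OF 1(1)]
      using Cons.IH(1)[where used = "used' used k" and k = "k' k", OF used'[of used k, OF 1(1)]] 1(2)
      by (simp add: H_def image_image)
  next
    case 2
    have "B = H k \<or> B \<in> set (assign_idx Xs (used' used k))"
      using 2(1) unfolding step[of used k, OF 2(2)] by simp
    moreover have "inj_on fst (H k)" by (simp add: H_def inj_on_def)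
    moreover have "inj_on fst B" if "B \<in> set (assign_idx Xs (used' used k))"
      using Cons.IH(2)[where used = "used' used k" and k = "k' k", OF that used'[of used k, OF 2(2)]] 2(3) by simp
    ultimately show ?case by blast
  next
    case 3
    have "card {Y \<in> set (X # Xs). i \<in> Y} = (if i \<in> X then 1 else 0) + card {Y \<in> set Xs. i \<in> Y}" for i
    proof -
      have "{Y \<in> set (X # Xs). i \<in> Y} = (if i \<in> X then insert X {Y \<in> set Xs. i \<in> Y} else {Y \<in> set Xs. i \<in> Y})"
        by auto
      then show ?thesis using 3(2) by simp
    qed
    then show ?case
      unfolding step[of used k, OF 3(1)] using union[of used k, OF 3(1)] 3(2) by (auto simp: H_def k'_def split: if_splits)
  next
    case 4
    have "disjnt (H k) B" if "B \<in> set (assign_idx Xs (used' used k))" for B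
    proof -
      have "B \<subseteq> {(i, j). k' k i < j}" using union[of used k, OF 4(1)] 4(2) that by auto
      then show ?thesis by (auto simp: disjnt_iff H_def k'_def)
    qed
    then show ?case
      unfolding step[of used k, OF 4(1)] using Cons.IH(4)[where used = "used' used k" and k = "k' k", OF used'[of used k, OF 4(1)]] 4(2)
      by (simp add: pairwise_insert disjnt_sym) }
qed

section \<open>Conjugate partitions and the type of a family\<close>

lemma downset_eq_lessThan:
  fixes D :: "nat set"
  assumes "finite D" "\<And>i j. j \<in> D \<Longrightarrow> i \<le> j \<Longrightarrow> i \<in> D"
  shows "D = {..<card D}"
proof (rule card_subset_eq)
  show "D \<subseteq> {..<card D}"
  proof
    fix r assume "r \<in> D"
    then have "{..r} \<subseteq> D" using assms(2) by auto
    from card_mono[OF assms(1) this] show "r \<in> {..<card D}" by simp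
  qed
qed (use assms in auto)

lemma partition_antitone:
  assumes "is_partition lam" "i \<le> j" "j < length lam"
  shows "lam ! j \<le> lam ! i"
proof (cases "i = j")
  case False
  have "sorted_wrt (\<ge>) lam" using assms(1) by (simp add: is_partition_def)
  from sorted_wrt_nth_less[OF this, of i j] show ?thesis using False assms by simp
qed simp

lemma part_le_largest:
  assumes "is_partition lam" "r < length lam"
  shows "lam ! r \<le> largest_part lam"
  using partition_antitone[OF assms(1), of 0 r] assms(2) by (auto simp: largest_part_def hd_conv_nth)

lemma le_conj_iff:
  assumes "is_partition lam"
  shows "r < conj lam i \<longleftrightarrow> r < length lam \<and> i \<le> lam ! r"
proof -
  define D where "D = {r. r < length lam \<and> i \<le> lam ! r}"
  have "D = {..<card D}"
    by (rule downset_eq_lessThan) (use partition_antitone[OF assms] in \<open>fastforce simp: D_def\<close>)+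
  then have "r \<in> D \<longleftrightarrow> r < card D" by blast
  then show ?thesis by (simp add: D_def conj_def)
qed

lemma mem_boxes_iff:
  assumes "is_partition lam"
  shows "(r, c) \<in> boxes lam \<longleftrightarrow> (c, r) \<in> symbols lam"
  \<comment> \<open>Boxes count rows from 1, list positions start at 0.\<close>
  using le_conj_iff[OF assms, of "r - 1" c] part_le_largest[OF assms, of "r - 1"]
  by (auto simp: boxes_def symbols_def)

lemma sum_conj:
  assumes "is_partition lam"
  shows "(\<Sum>i\<in>{1..largest_part lam}. conj lam i) = sum_list lam"
proof -
  have "(\<Sum>i\<in>{1..largest_part lam}. conj lam i) = (\<Sum>i\<in>{1..largest_part lam}. \<Sum>r<length lam. if i \<le> lam ! r then 1 else 0)"
    by (intro sum.cong refl) (simp add: conj_def sum.If_cases Int_def)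
  also have "\<dots> = (\<Sum>r<length lam. \<Sum>i\<in>{1..largest_part lam}. if i \<le> lam ! r then 1 else 0)"
    by (rule sum.swap)
  also have "\<dots> = (\<Sum>r<length lam. lam ! r)"
  proof (intro sum.cong refl)
    fix r assume "r \<in> {..<length lam}"
    then have "{1..largest_part lam} \<inter> {i. i \<le> lam ! r} = {1..lam ! r}"
      using part_le_largest[OF assms, of r] by auto
    then show "(\<Sum>i\<in>{1..largest_part lam}. if i \<le> lam ! r then 1 else 0) = lam ! r"
      by (simp add: sum.If_cases)
  qed
  finally show ?thesis by (simp add: sum_list_sum_nth atLeast0LessThan)
qed

text \<open>The type prescribes occurrences of the numbers up to the largest part only, but these
  already amount to \<open>m * n\<close>, the total size of all sets, so nothing is left for other
  numbers.\<close>

lemma type_support: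
  assumes lam: "is_partition lam" "sum_list lam = m * n"
    and P: "set_family m n P" "has_type P lam" and X: "X \<in> P"
  shows "X \<subseteq> {1..largest_part lam}"
proof -
  have fin: "finite P" "card P = n" and sub: "\<And>X. X \<in> P \<Longrightarrow> finite X \<and> card X = m"
    using P(1) by (auto simp: set_family_def m_subset_def)
  let ?I = "{1..largest_part lam}"
  have "(\<Sum>X\<in>P. card (X \<inter> ?I)) = (\<Sum>X\<in>P. \<Sum>i\<in>?I. if i \<in> X then 1 else 0)"
    by (intro sum.cong refl) (simp add: sum.If_cases Int_commute)
  also have "\<dots> = (\<Sum>i\<in>?I. \<Sum>X\<in>P. if i \<in> X then 1 else 0)" by (rule sum.swap)
  also have "\<dots> = (\<Sum>i\<in>?I. conj lam i)"
    using P(2) fin by (intro sum.cong refl) (simp add: has_type_def sum.If_cases Int_def)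
  also have "\<dots> = (\<Sum>X\<in>P. m)" using sum_conj[OF lam(1)] lam(2) fin by simp
  finally have eq: "(\<Sum>X\<in>P. card (X \<inter> ?I)) = (\<Sum>X\<in>P. m)" .
  have le: "card (X \<inter> ?I) \<le> m" if "X \<in> P" for X
    using sub[OF that] card_mono[of X "X \<inter> ?I"] by auto
  have "card (X \<inter> ?I) = m"
  proof (rule ccontr)
    assume "card (X \<inter> ?I) \<noteq> m"
    then have "card (X \<inter> ?I) < m" using le[OF X] by simp
    then have "(\<Sum>X\<in>P. card (X \<inter> ?I)) < (\<Sum>X\<in>P. m)"
      using le X fin by (intro sum_strict_mono_ex1) auto
    then show False using eq by simp
  qed
  then have "X \<inter> ?I = X" using sub[OF X] by (intro card_subset_eq) auto
  then show ?thesis by blast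
qed

lemma Union_assoc_isp:
  assumes lam: "is_partition lam" "sum_list lam = m * n" and P: "set_family m n P" "has_type P lam"
  shows "\<Union>(assoc_isp P) = symbols lam"
proof -
  have fin: "finite P" "\<And>X. X \<in> P \<Longrightarrow> finite X" using P(1) by (auto simp: set_family_def m_subset_def)
  have "\<Union>(assoc_isp P) = {(i, j). 0 < j \<and> j \<le> card {X \<in> P. i \<in> X}}"
    using assign_idx(3)[of "\<lambda>_. {}" "\<lambda>_. 0" "lex_list P"] lex_list[OF fin] by (simp add: assoc_isp_def)
  moreover have "0 < j \<and> j \<le> card {X \<in> P. i \<in> X} \<longleftrightarrow> 1 \<le> i \<and> i \<le> largest_part lam \<and> 1 \<le> j \<and> j \<le> conj lam i" for i j
  proof (cases "i \<in> {1..largest_part lam}")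
    case True
    then show ?thesis using P(2) by (auto simp: has_type_def)
  next
    case False
    then have "{X \<in> P. i \<in> X} = {}" using type_support[OF lam P] by blast
    then have "card {X \<in> P. i \<in> X} = 0" by (simp only: card.empty)
    then show ?thesis using False by auto
  qed
  ultimately show ?thesis by (simp add: symbols_def)
qed

section \<open>Tableaux and polytabloids as permutations of the cells\<close>

locale partition_diagram =
  fixes lam :: "nat list"
  assumes partition: "is_partition lam"

sublocale partition_diagram \<subseteq> young_diagram "largest_part lam" "conj lam"
proof
  fix i j :: nat assume "i \<le> j"
  then show "conj lam j \<le> conj lam i" unfolding conj_def by (intro card_mono) auto
qed

context partition_diagram
begin

lemma cells_eq_symbols: "cells = symbols lam"
  by (simp add: cells_def symbols_def)

lemma mem_boxes_iff_cells: "(r, c) \<in> boxes lam \<longleftrightarrow> (c, r) \<in> cells"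
  using mem_boxes_iff[OF partition] by (simp add: cells_eq_symbols)

definition row_tabloid :: tabloid where
  "row_tabloid = (\<lambda>x. if x \<in> cells then snd x else 0)"

lemma tab_act_comp:
  "\<sigma> permutes cells \<Longrightarrow> \<tau> permutes cells \<Longrightarrow> tab_act (tab_act T \<sigma>) \<tau> = tab_act T (\<tau> \<circ> \<sigma>)"
  by (simp add: tab_act_def o_inv_distrib permutes_bij comp_assoc)

lemma tab_act_id [simp]: "tab_act T id = T"
  by (simp add: tab_act_def inv_id)

lemma tab_act_eq_iff:
  assumes "\<sigma> permutes cells"
  shows "tab_act S \<sigma> = T \<longleftrightarrow> S = tab_act T (inv \<sigma>)"
  using assms by (auto simp: tab_act_comp permutes_inv comp_inv_cancel[OF assms])

lemma row_tabloid_act_eq_iff: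
  assumes "\<sigma> permutes cells" "\<tau> permutes cells"
  shows "tab_act row_tabloid \<sigma> = tab_act row_tabloid \<tau> \<longleftrightarrow> (\<forall>x\<in>cells. snd (inv \<sigma> x) = snd (inv \<tau> x))"
  using assms by (auto simp: tab_act_def row_tabloid_def fun_eq_iff permutes_in_image[OF permutes_inv])

text \<open>Here \<open>\<sigma>\<close> is the permutation taking \<open>t_lam\<close> to
  \<open>t\<close>. Boxes are pairs (row, column) and cells pairs (column, row), hence the exchanged
  coordinates.\<close>

lemma inv_into_tableau:
  assumes t: "tableau lam t" and \<sigma>: "\<sigma> permutes cells" "\<And>x. x \<in> cells \<Longrightarrow> \<sigma> x = t (snd x, fst x)"
    and x: "x \<in> cells"
  shows "inv_into (boxes lam) t x = (snd (inv \<sigma> x), fst (inv \<sigma> x))"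
proof (rule inv_into_f_eq)
  show "inj_on t (boxes lam)" using t by (simp add: tableau_def bij_betw_def)
  have mem: "inv \<sigma> x \<in> cells" using x permutes_in_image[OF permutes_inv[OF \<sigma>(1)]] by simp
  then show "(snd (inv \<sigma> x), fst (inv \<sigma> x)) \<in> boxes lam" by (simp add: mem_boxes_iff_cells)
  show "t (snd (inv \<sigma> x), fst (inv \<sigma> x)) = x"
    using \<sigma>(2)[OF mem] permutes_inverses[OF \<sigma>(1)] by simp
qed

lemma tabloid_of_tableau:
  assumes t: "tableau lam t" and \<sigma>: "\<sigma> permutes cells" "\<And>x. x \<in> cells \<Longrightarrow> \<sigma> x = t (snd x, fst x)"
  shows "tabloid_of lam t = tab_act row_tabloid \<sigma>"
  using inv_into_tableau[OF assms]
  by (auto simp: tabloid_of_def tab_act_def row_tabloid_def cells_eq_symbols[symmetric] permutes_in_image[OF permutes_inv[OF \<sigma>(1)]])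

lemma col_stab_tableau:
  assumes t: "tableau lam t" and \<sigma>: "\<sigma> permutes cells" "\<And>x. x \<in> cells \<Longrightarrow> \<sigma> x = t (snd x, fst x)"
  shows "col_stab lam t = stab cells (fst \<circ> inv \<sigma>)"
proof -
  have "snd (inv_into (boxes lam) t (\<tau> x)) = fst (inv \<sigma> (\<tau> x))" "snd (inv_into (boxes lam) t x) = fst (inv \<sigma> x)"
    if "\<tau> permutes cells" "x \<in> cells" for \<tau> x
    using inv_into_tableau[OF assms, of x] inv_into_tableau[OF assms, of "\<tau> x"] permutes_in_image[OF that(1)] that(2)
    by simp_all
  then show ?thesis unfolding col_stab_def stab_def cells_eq_symbols[symmetric] by auto
qed

lemma tableau_t_lam: "tableau lam t_lam"
  unfolding tableau_def
proof (rule bij_betw_byWitness[of _ "\<lambda>x. (snd x, fst x)"])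
qed (auto simp: t_lam_def mem_boxes_iff_cells cells_eq_symbols)

lemma col_stab_t_lam: "col_stab lam t_lam = stab cells fst"
  using col_stab_tableau[OF tableau_t_lam permutes_id] by (simp add: t_lam_def inv_id)

lemma polytabloid_t_lam:
  "polytabloid lam t_lam T = (\<Sum>\<tau>\<in>stab cells fst. if tab_act row_tabloid \<tau> = T then sign \<tau> else 0)"
proof -
  have "tabloid_of lam t_lam = row_tabloid"
    using tabloid_of_tableau[OF tableau_t_lam permutes_id] by (simp add: t_lam_def)
  then show ?thesis by (simp add: polytabloid_def col_stab_t_lam)
qed

lemma polytabloid_t_lam_eps:
  "g permutes cells \<Longrightarrow> polytabloid lam t_lam (tab_act row_tabloid g) = eps g"
  unfolding polytabloid_t_lam eps_def
  by (intro sum.cong refl) (auto simp: row_tabloid_act_eq_iff dest: stabD(1))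

text \<open>If \<open>\<sigma>\<close> takes \<open>t_lam\<close> to \<open>t\<close>, the column
  group of \<open>t\<close> is conjugate under \<open>\<sigma>\<close> to that of
  \<open>t_lam\<close>, so the polytabloid of \<open>t\<close> is the translate by
  \<open>\<sigma>\<close> of that of \<open>t_lam\<close>.\<close>

lemma polytabloid_translate:
  assumes t: "tableau lam t"
  shows "\<exists>\<sigma>. \<sigma> permutes cells \<and> polytabloid lam t = (\<lambda>T. polytabloid lam t_lam (tab_act T (inv \<sigma>)))"
proof -
  define \<sigma> where "\<sigma> x = (if x \<in> cells then t (snd x, fst x) else x)" for x
  have "bij_betw (\<lambda>x. (snd x, fst x)) cells (boxes lam)"
    by (rule bij_betw_byWitness[of _ "\<lambda>x. (snd x, fst x)"]) (auto simp: mem_boxes_iff_cells)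
  from bij_betw_trans[OF this] t have "bij_betw (t \<circ> (\<lambda>x. (snd x, fst x))) cells cells"
    by (simp add: tableau_def cells_eq_symbols)
  then have "bij_betw \<sigma> cells cells" by (rule bij_betw_cong[THEN iffD1, rotated]) (simp add: \<sigma>_def)
  then have \<sigma>: "\<sigma> permutes cells" by (rule bij_imp_permutes) (simp add: \<sigma>_def)
  have \<sigma>t: "\<sigma> x = t (snd x, fst x)" if "x \<in> cells" for x using that by (simp add: \<sigma>_def)
  have "polytabloid lam t T = polytabloid lam t_lam (tab_act T (inv \<sigma>))" for T
  proof -
    have "polytabloid lam t T = (\<Sum>\<tau>\<in>stab cells (fst \<circ> inv \<sigma>). if tab_act (tab_act row_tabloid \<sigma>) \<tau> = T then sign \<tau> else 0)"
      by (simp add: polytabloid_def tabloid_of_tableau[OF t \<sigma> \<sigma>t] col_stab_tableau[OF t \<sigma> \<sigma>t])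
    also have "\<dots> = (\<Sum>\<tau>\<in>stab cells fst. if tab_act (tab_act row_tabloid \<sigma>) (\<sigma> \<circ> \<tau> \<circ> inv \<sigma>) = T then sign (\<sigma> \<circ> \<tau> \<circ> inv \<sigma>) else 0)"
      using sum_stab_conj[OF \<sigma>, where \<mu> = "fst \<circ> inv \<sigma>" and H = "\<lambda>\<tau>. if tab_act (tab_act row_tabloid \<sigma>) \<tau> = T then sign \<tau> else 0"]
      by (simp add: comp_assoc comp_inv_cancel[OF \<sigma>])
    also have "\<dots> = (\<Sum>\<tau>\<in>stab cells fst. if tab_act row_tabloid \<tau> = tab_act T (inv \<sigma>) then sign \<tau> else 0)"
    proof (intro sum.cong refl)
      fix \<tau> assume "\<tau> \<in> stab cells fst"
      then have \<tau>: "\<tau> permutes cells" by (rule stabD(1))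
      note perm = permutes_imp_permutation[OF finite_cells]
      have "sign (\<sigma> \<circ> \<tau> \<circ> inv \<sigma>) = sign \<tau>"
        using perm[OF \<sigma>] perm[OF \<tau>] perm[OF permutes_inv[OF \<sigma>]] perm[OF permutes_compose[OF \<tau> \<sigma>]]
        by (simp add: sign_compose sign_inverse)
      moreover have "tab_act (tab_act row_tabloid \<sigma>) (\<sigma> \<circ> \<tau> \<circ> inv \<sigma>) = tab_act (tab_act row_tabloid \<tau>) \<sigma>"
        using \<sigma> \<tau> by (simp add: tab_act_comp permutes_compose permutes_inv comp_assoc comp_inv_cancel[OF \<sigma>])
      ultimately show "(if tab_act (tab_act row_tabloid \<sigma>) (\<sigma> \<circ> \<tau> \<circ> inv \<sigma>) = T then sign (\<sigma> \<circ> \<tau> \<circ> inv \<sigma>) else 0) =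
        (if tab_act row_tabloid \<tau> = tab_act T (inv \<sigma>) then sign \<tau> else 0)"
        by (simp add: tab_act_eq_iff[OF \<sigma>])
    qed
    finally show ?thesis by (simp add: polytabloid_t_lam)
  qed
  then show ?thesis using \<sigma> by blast
qed

lemma specht_combination:
  assumes "v \<in> specht lam"
  obtains I :: "(tabloid \<Rightarrow> int) set" and s c where "finite I" "\<And>i. i \<in> I \<Longrightarrow> s i permutes cells"
    "\<And>T. v T = (\<Sum>i\<in>I. c i * polytabloid lam t_lam (tab_act T (inv (s i))))"
proof -
  obtain I c where I: "finite I" "I \<subseteq> {polytabloid lam t | t. tableau lam t}" "v = (\<lambda>x. \<Sum>g\<in>I. c g * g x)"
    using assms by (auto simp: specht_def span_Z_def)
  have "\<exists>\<sigma>. \<sigma> permutes cells \<and> g = (\<lambda>T. polytabloid lam t_lam (tab_act T (inv \<sigma>)))" if "g \<in> I" for g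
    using I(2) that polytabloid_translate by blast
  then obtain s where s: "\<And>g. g \<in> I \<Longrightarrow> s g permutes cells"
    "\<And>g. g \<in> I \<Longrightarrow> g = (\<lambda>T. polytabloid lam t_lam (tab_act T (inv (s g))))" by metis
  have "v T = (\<Sum>g\<in>I. c g * polytabloid lam t_lam (tab_act T (inv (s g))))" for T
    unfolding I(3) by (intro sum.cong refl arg_cong2[of _ _ _ _ "(*)"] fun_cong[OF s(2)])
  then show ?thesis using that I(1) s(1) by blast
qed

text \<open>The \<open>\<tau>\<close>-term of \<open>eps g\<close> is present exactly when
  \<open>g = \<tau> \<circ> \<rho>\<close> with \<open>\<rho>\<close> in the row group. Summing over
  \<open>g\<close> therefore produces a row sum followed by the signed column sum.\<close>

lemma eps_sum:
  assumes F: "specht_like F" and \<sigma>: "\<sigma> permutes cells"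
  shows "(\<Sum>g | g permutes cells. eps g * F (\<sigma> \<circ> g)) = hook * F \<sigma>"
proof -
  have "(\<Sum>g | g permutes cells. eps g * F (\<sigma> \<circ> g)) = (\<Sum>\<tau>\<in>stab cells fst. \<Sum>g | g permutes cells.
      if \<forall>x\<in>cells. snd (inv \<tau> x) = snd (inv g x) then sign \<tau> * F (\<sigma> \<circ> g) else 0)"
    unfolding eps_def sum_distrib_right by (subst sum.swap) (intro sum.cong refl, simp)
  also have "\<dots> = (\<Sum>\<tau>\<in>stab cells fst. sign \<tau> * stab_sum cells snd F (\<sigma> \<circ> \<tau>))"
  proof (rule sum.cong[OF refl])
    fix \<tau> assume "\<tau> \<in> stab cells fst"
    then have \<tau>: "\<tau> permutes cells" by (rule stabD(1))
    have bij: "bij_betw (\<lambda>\<rho>. \<tau> \<circ> \<rho>) (stab cells snd) {g. g permutes cells \<and> (\<forall>x\<in>cells. snd (inv \<tau> x) = snd (inv g x))}"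
    proof (rule bij_betw_byWitness[of _ "\<lambda>g. inv \<tau> \<circ> g"])
      show "(\<lambda>\<rho>. \<tau> \<circ> \<rho>) ` stab cells snd \<subseteq> {g. g permutes cells \<and> (\<forall>x\<in>cells. snd (inv \<tau> x) = snd (inv g x))}"
      proof (clarify, intro conjI ballI)
        fix \<rho> x assume \<rho>: "\<rho> \<in> stab cells snd"
        show "\<tau> \<circ> \<rho> permutes cells" by (rule permutes_compose[OF stabD(1)[OF \<rho>] \<tau>])
        assume "x \<in> cells"
        then have "inv \<tau> x \<in> cells" using permutes_in_image[OF permutes_inv[OF \<tau>]] by simp
        from stabD(2)[OF stab_inv[OF \<rho>] this]
        show "snd (inv \<tau> x) = snd (inv (\<tau> \<circ> \<rho>) x)"
          using \<tau> stabD(1)[OF \<rho>] by (simp add: o_inv_distrib permutes_bij)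
      qed
      show "(\<lambda>g. inv \<tau> \<circ> g) ` {g. g permutes cells \<and> (\<forall>x\<in>cells. snd (inv \<tau> x) = snd (inv g x))} \<subseteq> stab cells snd"
      proof clarify
        fix g assume g: "g permutes cells" "\<forall>x\<in>cells. snd (inv \<tau> x) = snd (inv g x)"
        have "snd (inv \<tau> (g x)) = snd x" if "x \<in> cells" for x
          using g(2) permutes_in_image[OF g(1), of x] permutes_inverses[OF g(1)] that by auto
        then show "inv \<tau> \<circ> g \<in> stab cells snd"
          using permutes_compose[OF g(1) permutes_inv[OF \<tau>]] by (simp add: stab_def)
      qed
    qed (auto simp: comp_inv_cancel[OF \<tau>])
    have "(\<Sum>g | g permutes cells. if \<forall>x\<in>cells. snd (inv \<tau> x) = snd (inv g x) then sign \<tau> * F (\<sigma> \<circ> g) else 0) =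
      (\<Sum>g | g permutes cells \<and> (\<forall>x\<in>cells. snd (inv \<tau> x) = snd (inv g x)). sign \<tau> * F (\<sigma> \<circ> g))"
      using finite_permutations[OF finite_cells] by (simp add: sum.If_cases Collect_conj_eq)
    also have "\<dots> = (\<Sum>\<rho>\<in>stab cells snd. sign \<tau> * F (\<sigma> \<circ> (\<tau> \<circ> \<rho>)))"
      by (rule sum.reindex_bij_betw[OF bij, symmetric])
    finally show "(\<Sum>g | g permutes cells. if \<forall>x\<in>cells. snd (inv \<tau> x) = snd (inv g x) then sign \<tau> * F (\<sigma> \<circ> g) else 0) =
      sign \<tau> * stab_sum cells snd F (\<sigma> \<circ> \<tau>)"
      by (simp add: stab_sum_def sum_distrib_left comp_assoc)
  qed
  finally show ?thesis using column_row_sum[OF F \<sigma>] by simp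
qed

end

section \<open>The homomorphism\<close>

locale foulkes_hom =
  partition_diagram lam + foulkes_family "largest_part lam" "conj lam" m P u
  for lam :: "nat list" and m :: nat and P :: "nat set set" and u :: "sym set set"
begin

text \<open>The sum is the image of \<open>h\<close> under \<open>{t_lam} g \<mapsto> v r g\<close>. The division is exact only on the Specht module.\<close>

definition foulkes_map :: "(tabloid \<Rightarrow> int) \<Rightarrow> sym set set \<Rightarrow> int" where
  "foulkes_map h = (\<lambda>U. (\<Sum>g | g permutes cells. h (tab_act row_tabloid g) * coefficient U g) div hook)"

lemma hook_nonzero': "hook \<noteq> 0"
  using hook_nonzero[OF specht_like_coefficient permutes_id, of u] coefficient_nonzero by simp

text \<open>If \<open>v\<close> is a combination of translates of the polytabloid of
  \<open>t_lam\<close>, the undivided sum is \<open>hook\<close> times the same combination of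
  translates of \<open>u b\<close>. The left side depends on \<open>v\<close> alone; hence,
  \<open>hook\<close> being nonzero, the combination on the right does not depend on how
  \<open>v\<close> is written.\<close>

lemma foulkes_map_sum:
  assumes s: "\<And>i. i \<in> I \<Longrightarrow> s i permutes cells"
    and v: "\<And>T. v T = (\<Sum>i\<in>I. c i * polytabloid lam t_lam (tab_act T (inv (s i))))"
  shows "(\<Sum>g | g permutes cells. v (tab_act row_tabloid g) * coefficient U g) = hook * (\<Sum>i\<in>I. c i * coefficient U (s i))"
proof -
  have "(\<Sum>g | g permutes cells. v (tab_act row_tabloid g) * coefficient U g) =
    (\<Sum>i\<in>I. \<Sum>g | g permutes cells. c i * (polytabloid lam t_lam (tab_act (tab_act row_tabloid g) (inv (s i))) * coefficient U g))"
    unfolding v sum_distrib_right by (subst sum.swap) (simp only: mult.assoc)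
  also have "\<dots> = (\<Sum>i\<in>I. c i * (\<Sum>g | g permutes cells. eps (inv (s i) \<circ> g) * coefficient U g))"
    unfolding sum_distrib_left
    using s by (intro sum.cong refl)
      (simp add: tab_act_comp permutes_inv polytabloid_t_lam_eps permutes_compose)
  also have "\<dots> = (\<Sum>i\<in>I. c i * (hook * coefficient U (s i)))"
  proof (intro sum.cong refl arg_cong2[of _ _ _ _ "(*)"])
    fix i assume "i \<in> I"
    note si = s[OF this]
    have "(\<Sum>g | g permutes cells. eps (inv (s i) \<circ> g) * coefficient U g) =
      (\<Sum>g | g permutes cells. eps g * coefficient U (s i \<circ> g))"
      using sum_permutes_left[OF si, of "\<lambda>g. eps (inv (s i) \<circ> g) * coefficient U g"]
      by (simp add: comp_inv_cancel[OF si])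
    also have "\<dots> = hook * coefficient U (s i)" by (rule eps_sum[OF specht_like_coefficient si])
    finally show "(\<Sum>g | g permutes cells. eps (inv (s i) \<circ> g) * coefficient U g) = hook * coefficient U (s i)" .
  qed
  finally show ?thesis by (simp add: sum_distrib_left mult.left_commute)
qed

lemma foulkes_map_eq:
  assumes s: "\<And>i. i \<in> I \<Longrightarrow> s i permutes cells"
    and v: "\<And>T. v T = (\<Sum>i\<in>I. c i * polytabloid lam t_lam (tab_act T (inv (s i))))"
  shows "foulkes_map v U = (\<Sum>i\<in>I. c i * coefficient U (s i))"
  unfolding foulkes_map_def by (subst foulkes_map_sum[OF s v]) (simp_all add: hook_nonzero')

lemma hook_dvd:
  assumes "v \<in> specht lam"
  shows "hook dvd (\<Sum>g | g permutes cells. v (tab_act row_tabloid g) * coefficient U g)"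
proof -
  obtain I :: "(tabloid \<Rightarrow> int) set" and s c where "finite I" and s: "\<And>i. i \<in> I \<Longrightarrow> s i permutes cells"
    and v_eq: "\<And>T. v T = (\<Sum>i\<in>I. c i * polytabloid lam t_lam (tab_act T (inv (s i))))"
    by (rule specht_combination[OF assms]) (rule that)
  from foulkes_map_sum[of I s v c U, OF s v_eq] show ?thesis by simp
qed

text \<open>Integer division is additive once the divisor divides a summand, which holds on the
  Specht module.\<close>

lemma foulkes_map_add:
  assumes "v \<in> specht lam" "w \<in> specht lam"
  shows "foulkes_map (\<lambda>x. v x + w x) = (\<lambda>U. foulkes_map v U + foulkes_map w U)"
  unfolding foulkes_map_def
  by (simp add: distrib_right sum.distrib div_plus_div_distrib_dvd_left[OF hook_dvd[OF assms(1)]])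

lemma foulkes_map_vec_act:
  assumes \<sigma>: "\<sigma> permutes cells"
  shows "foulkes_map (vec_act tab_act h \<sigma>) = vec_act isp_act (foulkes_map h) \<sigma>"
proof
  fix U
  have "(\<Sum>g | g permutes cells. h (tab_act (tab_act row_tabloid g) (inv \<sigma>)) * coefficient U g) =
    (\<Sum>g | g permutes cells. h (tab_act row_tabloid (inv \<sigma> \<circ> g)) * coefficient U g)"
    using \<sigma> by (intro sum.cong refl) (simp add: tab_act_comp permutes_inv)
  also have "\<dots> = (\<Sum>g | g permutes cells. h (tab_act row_tabloid g) * coefficient U (\<sigma> \<circ> g))"
    using sum_permutes_left[OF \<sigma>, of "\<lambda>g. h (tab_act row_tabloid (inv \<sigma> \<circ> g)) * coefficient U g"]
    by (simp add: comp_inv_cancel[OF \<sigma>])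
  also have "\<dots> = (\<Sum>g | g permutes cells. h (tab_act row_tabloid g) * coefficient (isp_act U (inv \<sigma>)) g)"
    using \<sigma> by (intro sum.cong refl) (simp add: coefficient_translate)
  finally show "foulkes_map (vec_act tab_act h \<sigma>) U = vec_act isp_act (foulkes_map h) \<sigma> U"
    by (simp add: foulkes_map_def vec_act_def)
qed

lemma foulkes_map_polytabloid:
  "foulkes_map (polytabloid lam t_lam) = (\<lambda>U. \<Sum>\<tau>\<in>col_stab lam t_lam. if isp_act u \<tau> = U then sign \<tau> else 0)"
proof
  fix U
  \<comment> \<open>The polytabloid is a combination with a single term, translated by
    \<open>id\<close>.\<close>
  have "foulkes_map (polytabloid lam t_lam) U = (\<Sum>i\<in>{()}. 1 * coefficient U id)"
    by (rule foulkes_map_eq) (simp_all add: permutes_id inv_id)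
  then show "foulkes_map (polytabloid lam t_lam) U = (\<Sum>\<tau>\<in>col_stab lam t_lam. if isp_act u \<tau> = U then sign \<tau> else 0)"
    by (simp add: coefficient_def signed_orbit_def inv_id col_stab_t_lam)
qed

lemma isp_act_isp:
  assumes U: "U \<in> isp m n lam" and \<sigma>: "\<sigma> permutes cells"
  shows "isp_act U \<sigma> \<in> isp m n lam"
proof -
  note inj = permutes_inj[OF \<sigma>]
  have img: "\<sigma> ` symbols lam = symbols lam" using permutes_image[OF \<sigma>] by (simp add: cells_eq_symbols)
  have U': "card U = n" "\<And>B. B \<in> U \<Longrightarrow> B \<subseteq> symbols lam \<and> card B = m" "\<Union>U = symbols lam" "pairwise disjnt U"
    using U by (simp_all add: isp_def)
  have "card (isp_act U \<sigma>) = n"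
    unfolding isp_act_def U'(1)[symmetric] by (intro card_image inj_onI) (simp add: inj_image_eq_iff[OF inj])
  moreover have "B \<subseteq> symbols lam \<and> card B = m" if B: "B \<in> isp_act U \<sigma>" for B
  proof -
    obtain B' where B': "B' \<in> U" "B = \<sigma> ` B'" using B by (auto simp: isp_act_def)
    have "\<sigma> ` B' \<subseteq> symbols lam" using U'(2)[OF B'(1)] img by blast
    then show ?thesis
      using U'(2)[OF B'(1)] B'(2) card_image[OF inj_on_subset[OF inj subset_UNIV], of B'] by simp
  qed
  moreover have "\<Union>(isp_act U \<sigma>) = symbols lam"
    unfolding isp_act_def image_Union[symmetric] U'(3) by (rule img)
  moreover have "pairwise disjnt (isp_act U \<sigma>)" by (rule pairwise_disjnt_isp_act[OF inj U'(4)])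
  ultimately show ?thesis by (simp add: isp_def)
qed

text \<open>The values are supported on the orbit of \<open>u\<close> under the symmetric group,
  which is finite and consists of indexed set partitions.\<close>

lemma foulkes_map_in_foulkes:
  assumes u: "u \<in> isp m n lam" and v: "v \<in> specht lam"
  shows "foulkes_map v \<in> foulkes m n lam"
proof -
  obtain I :: "(tabloid \<Rightarrow> int) set" and s c where "finite I" and s: "\<And>i. i \<in> I \<Longrightarrow> s i permutes cells"
    and v_eq: "\<And>T. v T = (\<Sum>i\<in>I. c i * polytabloid lam t_lam (tab_act T (inv (s i))))"
    by (rule specht_combination[OF v]) (rule that)
  have orbit: "U \<in> isp_act u ` {g. g permutes cells}" if nz: "foulkes_map v U \<noteq> 0" for U
  proof -
    have "(\<Sum>i\<in>I. c i * coefficient U (s i)) \<noteq> 0" using nz foulkes_map_eq[of I s v c U, OF s v_eq] by simp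
    then obtain i where i: "i \<in> I" "coefficient U (s i) \<noteq> 0"
      by (rule sum.not_neutral_contains_not_neutral) auto
    obtain \<tau> where \<tau>: "\<tau> \<in> stab cells fst" "isp_act u \<tau> = isp_act U (inv (s i))"
      using i(2) unfolding coefficient_def signed_orbit_def
      by (rule sum.not_neutral_contains_not_neutral) (auto split: if_splits)
    have "U = isp_act (isp_act u \<tau>) (s i)"
      using isp_act_eq_iff[OF s[OF i(1)], of "isp_act u \<tau>" U] \<tau>(2) by simp
    then have "U = isp_act u (s i \<circ> \<tau>)" by (simp only: isp_act_comp)
    then show ?thesis using permutes_compose[OF stabD(1)[OF \<tau>(1)] s[OF i(1)]] by blast
  qed
  have "finite (isp_act u ` {g. g permutes cells})"
    by (intro finite_imageI finite_permutations finite_cells)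
  then have "finite {U. foulkes_map v U \<noteq> 0}" by (rule finite_subset[rotated]) (use orbit in blast)
  moreover have "U \<in> isp m n lam" if "foulkes_map v U \<noteq> 0" for U
    using orbit[OF that] isp_act_isp[OF u] by blast
  ultimately show ?thesis by (simp add: foulkes_def)
qed

text \<open>Pairing with the row sum translated by \<open>k\<close> turns each
  \<open>coefficient\<close> into \<open>eps\<close>, the polytabloid coefficient at
  \<open>{t_lam} k\<close>. Linearity then recovers the coefficient of \<open>v\<close> at that
  tabloid, up to two positive factors.\<close>

lemma foulkes_map_pairing:
  assumes v: "v \<in> specht lam" and k: "k permutes cells"
  defines "F \<equiv> coefficient u"
  shows "int (card (stab cells snd)) *
    (\<Sum>g | g permutes cells. foulkes_map v (isp_act u (inv g)) * stab_sum cells snd F (g \<circ> k)) =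
    row_norm F * v (tab_act row_tabloid k)"
proof -
  obtain I :: "(tabloid \<Rightarrow> int) set" and s c where "finite I" and s: "\<And>i. i \<in> I \<Longrightarrow> s i permutes cells"
    and v_eq: "\<And>T. v T = (\<Sum>i\<in>I. c i * polytabloid lam t_lam (tab_act T (inv (s i))))"
    by (rule specht_combination[OF v]) (rule that)
  let ?r = "stab_sum cells snd F"
  have pair: "int (card (stab cells snd)) * (\<Sum>g | g permutes cells. F (g \<circ> s i) * ?r (g \<circ> k)) = eps (inv (s i) \<circ> k) * row_norm F"
    if "i \<in> I" for i
  proof -
    note si = s[OF that]
    have perm: "inv k \<circ> s i permutes cells" by (rule permutes_compose[OF si permutes_inv[OF k]])
    have "(\<Sum>g | g permutes cells. F (g \<circ> s i) * ?r (g \<circ> k)) = (\<Sum>g | g permutes cells. F (g \<circ> (inv k \<circ> s i)) * ?r g)"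
      using sum_permutes_right[OF k, of "\<lambda>g. F (g \<circ> (inv k \<circ> s i)) * ?r g"]
      by (simp add: comp_assoc comp_inv_cancel[OF k])
    moreover have "inv (inv k \<circ> s i) = inv (s i) \<circ> k"
      using inv_comp_permutes[OF permutes_inv[OF k] si] by (simp add: permutes_inv_inv[OF k])
    ultimately show ?thesis
      using row_pairing[OF specht_like_coefficient perm, of u] by (simp add: F_def)
  qed
  have "foulkes_map v (isp_act u (inv g)) = (\<Sum>i\<in>I. c i * F (g \<circ> s i))" if "g permutes cells" for g
    using foulkes_map_eq[of I s v c, OF s v_eq] s that by (auto simp: F_def coefficient_translate intro!: sum.cong)
  then have "(\<Sum>g | g permutes cells. foulkes_map v (isp_act u (inv g)) * ?r (g \<circ> k)) =
    (\<Sum>g | g permutes cells. \<Sum>i\<in>I. c i * (F (g \<circ> s i) * ?r (g \<circ> k)))"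
    by (intro sum.cong refl) (simp add: sum_distrib_right mult.assoc)
  also have "\<dots> = (\<Sum>i\<in>I. c i * (\<Sum>g | g permutes cells. F (g \<circ> s i) * ?r (g \<circ> k)))"
    by (subst sum.swap) (simp only: sum_distrib_left)
  finally have "int (card (stab cells snd)) * (\<Sum>g | g permutes cells. foulkes_map v (isp_act u (inv g)) * ?r (g \<circ> k)) =
    (\<Sum>i\<in>I. c i * (int (card (stab cells snd)) * (\<Sum>g | g permutes cells. F (g \<circ> s i) * ?r (g \<circ> k))))"
    by (simp only: sum_distrib_left mult.left_commute)
  also have "\<dots> = (\<Sum>i\<in>I. c i * (eps (inv (s i) \<circ> k) * row_norm F))" by (simp add: pair)
  also have "\<dots> = row_norm F * (\<Sum>i\<in>I. c i * eps (inv (s i) \<circ> k))"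
    unfolding sum_distrib_left by (intro sum.cong refl) (simp only: mult_ac)
  also have "(\<Sum>i\<in>I. c i * eps (inv (s i) \<circ> k)) = v (tab_act row_tabloid k)"
    unfolding v_eq using s k
    by (intro sum.cong refl) (simp add: tab_act_comp permutes_inv polytabloid_t_lam_eps permutes_compose)
  finally show ?thesis .
qed

text \<open>Tabloids are encoded as arbitrary functions. Only those reached by the pairing can carry
  a nonzero coefficient, so the pairing determines all of \<open>v\<close>.\<close>

lemma specht_support:
  assumes v: "v \<in> specht lam" and nz: "v T \<noteq> 0"
  shows "\<exists>k. k permutes cells \<and> T = tab_act row_tabloid k"
proof -
  obtain I :: "(tabloid \<Rightarrow> int) set" and s c where "finite I" and s: "\<And>i. i \<in> I \<Longrightarrow> s i permutes cells"
    and v_eq: "\<And>T. v T = (\<Sum>i\<in>I. c i * polytabloid lam t_lam (tab_act T (inv (s i))))"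
    by (rule specht_combination[OF v]) (rule that)
  obtain i where i: "i \<in> I" "polytabloid lam t_lam (tab_act T (inv (s i))) \<noteq> 0"
    using nz unfolding v_eq by (rule sum.not_neutral_contains_not_neutral) auto
  obtain \<tau> where \<tau>: "\<tau> \<in> stab cells fst" "tab_act row_tabloid \<tau> = tab_act T (inv (s i))"
    using i(2) unfolding polytabloid_t_lam
    by (rule sum.not_neutral_contains_not_neutral) (auto split: if_splits)
  note si = s[OF i(1)]
  have "T = tab_act (tab_act row_tabloid \<tau>) (s i)"
    using tab_act_eq_iff[OF si, of "tab_act row_tabloid \<tau>" T] \<tau>(2) by simp
  then show ?thesis
    using tab_act_comp[OF stabD(1)[OF \<tau>(1)] si] permutes_compose[OF stabD(1)[OF \<tau>(1)] si] by auto
qed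

lemma inj_on_foulkes_map: "inj_on foulkes_map (specht lam)"
proof (rule inj_onI)
  fix v w assume v: "v \<in> specht lam" and w: "w \<in> specht lam" and eq: "foulkes_map v = foulkes_map w"
  have "row_norm (coefficient u) \<noteq> 0"
    using row_norm_pos[OF specht_like_coefficient permutes_id, of u] coefficient_nonzero by simp
  then have on_orbit: "v (tab_act row_tabloid k) = w (tab_act row_tabloid k)" if "k permutes cells" for k
    using foulkes_map_pairing[OF v that] foulkes_map_pairing[OF w that] eq by simp
  show "v = w"
  proof
    fix T show "v T = w T"
      using specht_support[OF v, of T] specht_support[OF w, of T] on_orbit by metis
  qed
qed

end

theorem theorem1p1:
  fixes m n :: nat and lam :: "nat list" and P :: "nat set set"
  assumes "odd m" and "n \<ge> 1"
    and "is_partition lam" and "sum_list lam = m * n"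
    and "set_family m n P" and "closed_family m P" and "has_type P lam"
  shows "\<exists>f :: (tabloid \<Rightarrow> int) \<Rightarrow> (sym set set \<Rightarrow> int).
           f ` specht lam \<subseteq> foulkes m n lam
         \<and> (\<forall>v\<in>specht lam. \<forall>w\<in>specht lam. f (\<lambda>x. v x + w x) = (\<lambda>U. f v U + f w U))
         \<and> (\<forall>\<sigma>. \<sigma> permutes symbols lam \<longrightarrow>
              (\<forall>v\<in>specht lam. f (vec_act tab_act v \<sigma>) = vec_act isp_act (f v) \<sigma>))
         \<and> f (polytabloid lam t_lam) =
             (\<lambda>U. \<Sum>\<tau>\<in>col_stab lam t_lam. if isp_act (assoc_isp P) \<tau> = U then sign \<tau> else 0)
         \<and> inj_on f (specht lam)"
proof -
  interpret D: partition_diagram lam by unfold_locales fact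
  have sets: "\<And>X. X \<in> P \<Longrightarrow> m_subset m X" and P: "finite P" "card P = n"
    using assms(5) by (auto simp: set_family_def)
  have fin: "\<And>X. X \<in> P \<Longrightarrow> finite X" using sets by (auto simp: m_subset_def)
  note lex = lex_list[OF P(1) fin]
  let ?L = "assign_idx (lex_list P) (\<lambda>_. {})"
  \<comment> \<open>Initially no index has been given out, so \<open>k\<close> is 0
    throughout.\<close>
  have L: "map ((`) fst) ?L = lex_list P" "\<And>B. B \<in> set ?L \<Longrightarrow> inj_on fst B" "pairwise disjnt (set ?L)"
    using assign_idx[where used = "\<lambda>_. {}" and k = "\<lambda>_. 0" and Xs = "lex_list P"] lex(1) by simp_all
  have u: "assoc_isp P = set ?L" by (simp add: assoc_isp_def)
  have Un: "\<Union>(assoc_isp P) = symbols lam" by (rule Union_assoc_isp) fact+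
  have inj: "inj_on ((`) fst) (assoc_isp P)"
    unfolding u using L(1) lex(1) by (metis distinct_map)
  have image: "((`) fst) ` assoc_isp P = P"
    unfolding u using L(1) lex(2) by (metis set_map)
  interpret foulkes_hom lam m P "assoc_isp P"
  proof unfold_locales
    show "\<Union>(assoc_isp P) = D.cells" by (simp add: Un D.cells_eq_symbols)
  qed (use assms sets L(2,3) inj image in \<open>simp_all add: u\<close>)
  have "card (assoc_isp P) = n" using card_image[OF inj] image P(2) by simp
  then have isp: "assoc_isp P \<in> isp m n lam"
    using card_block disj Un by (auto simp: isp_def)
  show ?thesis
  proof (intro exI[of _ foulkes_map] conjI ballI allI impI)
    show "foulkes_map ` specht lam \<subseteq> foulkes m n lam" using foulkes_map_in_foulkes[OF isp] by blast
    show "foulkes_map (vec_act tab_act v \<sigma>) = vec_act isp_act (foulkes_map v) \<sigma>" if "\<sigma> permutes symbols lam" for v \<sigma>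
      using that by (intro foulkes_map_vec_act) (simp add: D.cells_eq_symbols)
  qed (simp_all add: foulkes_map_add foulkes_map_polytabloid inj_on_foulkes_map)
qed

end
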